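(* Let $a,b,c,\mu\in\mathbb{C}$. In each identity below assume that the arguments of the three gamma functions in the numerator on the right-hand side have positive real parts, and that the lower (third) parameters of the hypergeometric functions in the two $w_j$'s occurring are not in $\mathbb{Z}_{\le0}$. (1) For $x\in(0,1)\cup(1,\infty)$: $$\int_{-\infty}^0(-y)^{c-a-\mu-1}(1-y)^{a+b-c}w_3(y;a,b,c)(x-y)^{\mu-1}dy=\frac{\Gamma(-a-\mu+1)\Gamma(c-a-\mu)\Gamma(a-b+1)}{\Gamma(c-a-b-\mu+1)\Gamma(1-\mu)}\,x^{c-a-1}|1-x|^{a+b-c+\mu}w_6(x;a+\mu,b,c).$$ (2) For $x\in(-\infty,0)\cup(1,\infty)$: $$\int_0^1y^{c-a-\mu-1}(1-y)^{a+b-c}w_5(y;a,b,c)|x-y|^{\mu-1}dy=\frac{\Gamma(-a-\mu+1)\Gamma(c-a-\mu)\Gamma(a+b-c+1)}{\Gamma(b-a-\mu+1)\Gamma(1-\mu)}\,|x|^{c-a-1}|1-x|^{a+b-c+\mu}w_4(x;a+\mu,b,c).$$ (3) For $x\in(0,1)\cup(1,\infty)$: $$\int_{-\infty}^0(-y)^{c-b-\mu-1}(1-y)^{a+b-c}w_4(y;a,b,c)(x-y)^{\mu-1}dy=\frac{\Gamma(-b-\mu+1)\Gamma(c-b-\mu)\Gamma(b-a+1)}{\Gamma(c-a-b-\mu+1)\Gamma(1-\mu)}\,x^{c-b-1}|1-x|^{a+b-c+\mu}w_6(x;a,b+\mu,c).$$ (4) For $x\in(-\infty,0)\cup(1,\infty)$: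 $$\int_0^1y^{c-b-\mu-1}(1-y)^{a+b-c}w_5(y;a,b,c)|x-y|^{\mu-1}dy=\frac{\Gamma(-b-\mu+1)\Gamma(c-b-\mu)\Gamma(a+b-c+1)}{\Gamma(a-b-\mu+1)\Gamma(1-\mu)}\,|x|^{c-b-1}|1-x|^{a+b-c+\mu}w_3(x;a,b+\mu,c).$$
   Context: Write $F(a,b;c;z)={}_2F_1(a,b;c;z)$ for the Gauss hypergeometric function (power series for $|z|<1$, analytically continued to $\mathbb{C}\setminus[1,\infty)$, with $c\notin\mathbb{Z}_{\le0}$). Define $w_3(x;a,b,c)=|x|^{-a}F(a,a-c+1;a-b+1;x^{-1})$ for $x\in(-\infty,0)\cup(1,\infty)$; $w_4(x;a,b,c)=|x|^{-b}F(b,b-c+1;b-a+1;x^{-1})$ for $x\in(-\infty,0)\cup(1,\infty)$; $w_5(x;a,b,c)=F(a,b;a+b-c+1;1-x)$ for $x\in(0,\infty)$; $w_6(x;a,b,c)=|1-x|^{c-a-b}F(c-a,c-b;c-a-b+1;1-x)$ for $x\in(0,1)\cup(1,\infty)$. Convention: $1/\Gamma$ is entire, with value $0$ at nonpositive integers. *)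

theory Defs
  imports "HOL-Analysis.Analysis"
begin

(* The unique holomorphic function on the slit plane that extends the Gauss series.  The
   identity theorem makes the choice unique on the slit plane; on the slit itself, and for
   c a nonpositive integer, the value carries no meaning. *)
definition hyp2F1 :: "complex \<Rightarrow> complex \<Rightarrow> complex \<Rightarrow> complex \<Rightarrow> complex" where
  "hyp2F1 a b c =
     (SOME f. f holomorphic_on (- (complex_of_real ` {1..})) \<and>
       (\<forall>z. norm z < 1 \<longrightarrow>
         (\<lambda>n. pochhammer a n * pochhammer b n / (pochhammer c n * fact n) * z ^ n) sums f z))"

definition w\<^sub>3 :: "real \<Rightarrow> complex \<Rightarrow> complex \<Rightarrow> complex \<Rightarrow> complex" where
  "w\<^sub>3 x a b c =
     of_real \<bar>x\<bar> powr (- a) * hyp2F1 a (a - c + 1) (a - b + 1) (of_real (inverse x))"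

definition w\<^sub>4 :: "real \<Rightarrow> complex \<Rightarrow> complex \<Rightarrow> complex \<Rightarrow> complex" where
  "w\<^sub>4 x a b c =
     of_real \<bar>x\<bar> powr (- b) * hyp2F1 b (b - c + 1) (b - a + 1) (of_real (inverse x))"

definition w\<^sub>5 :: "real \<Rightarrow> complex \<Rightarrow> complex \<Rightarrow> complex \<Rightarrow> complex" where
  "w\<^sub>5 x a b c = hyp2F1 a b (a + b - c + 1) (of_real (1 - x))"

definition w\<^sub>6 :: "real \<Rightarrow> complex \<Rightarrow> complex \<Rightarrow> complex \<Rightarrow> complex" where
  "w\<^sub>6 x a b c =
     of_real \<bar>1 - x\<bar> powr (c - a - b)
       * hyp2F1 (c - a) (c - b) (c - a - b + 1) (of_real (1 - x))"

end

theory Submission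
  imports Defs "HOL-Complex_Analysis.Complex_Analysis"
begin

text \<open>
  All four integrals reduce to one. The substitution \<open>y = s\<close> in (2), respectively
  \<open>y = - s / (1 - s)\<close> followed by Pfaff's transformation in (1), turns the left-hand side into
  a constant multiple of the integral over \<open>s \<in> (0,1)\<close> of
  \<open>s powr (\<delta> - 1) (1 - s) powr (\<gamma> - 1) F(\<alpha>, \<beta>; \<gamma>; 1 - s) (1 - \<eta> s) powr (\<mu> - 1)\<close>, where
  \<open>\<gamma> + \<delta> - \<beta> = 1 - \<mu>\<close>. Both sides are holomorphic in \<open>\<eta>\<close> off the slit, so it suffices to
  compare Taylor coefficients at \<open>\<eta> = 0\<close>. These are the moments of the weight, and
  integrating the Gauss series term by term and summing with Gauss's theorem evaluates them
  as quotients of Gamma values. Cases (3) and (4) are (1) and (2) with \<open>a\<close> and \<open>b\<close> exchanged.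
\<close>

text \<open>\<open>hyp2F1\<close> is picked by a choice operator, so nothing is known about it until
  some holomorphic extension is shown to exist; Euler's integral supplies one in a limited range of
  parameters. The exponent condition in the overview is what keeps the answer a 2F1: the k-th Taylor
  coefficient of the kernel carries (1 - \<mu>)_k, the k-th moment carries 1/Gamma(\<gamma> +
  \<delta> - \<beta> + k), and their product is 1/Gamma(1 - \<mu>) for every k, even if 1 - \<mu> is
  a nonpositive integer. A general exponent would leave a 3F2. The parameter \<eta> is 1/x in (2)
  and 1 - 1/x in (1). In both cases the comparison yields F(1 - a - \<mu>, c - a - \<mu>; C;
  \<eta>), with C the lower parameter of the solution on the right-hand side; Euler's transformation
  turns this into \<open>w\<^sub>4\<close> in (2), Pfaff's into \<open>w\<^sub>6\<close> in
  (1).\<close>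

section \<open>Holomorphic parameter integrals and the complex Beta integral\<close>

text \<open>Cauchy's estimate turns a local bound on \<open>f\<close> into one on its difference
  quotients, so that dominated convergence applies to them; this is why the domination hypothesis
  speaks of \<open>f\<close> alone.\<close>

lemma holomorphic_on_integral:
  fixes f :: "complex \<Rightarrow> 'a \<Rightarrow> complex"
  assumes A: "open A"
    and hol: "\<And>x. x \<in> space M \<Longrightarrow> (\<lambda>z. f z x) holomorphic_on A"
    and meas: "\<And>z. z \<in> A \<Longrightarrow> f z \<in> borel_measurable M"
    and dom: "\<And>z. z \<in> A \<Longrightarrow> \<exists>r>0. \<exists>w. ball z r \<subseteq> A \<and> integrable M w \<and>
                (\<forall>u\<in>ball z r. \<forall>x\<in>space M. norm (f u x) \<le> w x)"
  shows "(\<lambda>z. integral\<^sup>L M (f z)) holomorphic_on A"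
proof -
  have int: "integrable M (f z)" if z: "z \<in> A" for z
  proof -
    obtain r w where "r > 0" "integrable M w" "\<forall>u\<in>ball z r. \<forall>x\<in>space M. norm (f u x) \<le> w x"
      using dom[OF z] by blast
    then show ?thesis
      by (intro Bochner_Integration.integrable_bound[OF \<open>integrable M w\<close> meas[OF z]] AE_I2)
         (metis centre_in_ball abs_ge_self order_trans real_norm_def)
  qed
  have "\<exists>D. ((\<lambda>z. integral\<^sup>L M (f z)) has_field_derivative D) (at z)" if z: "z \<in> A" for z
  proof -
    obtain r w where r: "r > 0" "ball z r \<subseteq> A" and w: "integrable M w"
      and bd: "\<And>u x. u \<in> ball z r \<Longrightarrow> x \<in> space M \<Longrightarrow> norm (f u x) \<le> w x"
      using dom[OF z] by blast
    define q where "q u x = (f u x - f z x) / (u - z)" for u x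
    define d where "d x = (if x \<in> space M then deriv (\<lambda>z. f z x) z else 0)" for x
    \<comment> \<open>Discs of radius r/4 about points of the half-size ball stay inside
      \<open>ball z r\<close>. Cauchy's estimate on them gives the factor 4 / r, and the mean value
      inequality on the convex half-size ball carries it over to the quotient.\<close>
    have bdq: "norm (q u x) \<le> 4 / r * w x" if u: "u \<in> ball z (r/2)" "u \<noteq> z" and x: "x \<in> space M" for u x
    proof -
      have w0: "0 \<le> w x" using bd[of z x] r x by (auto intro: order_trans[OF norm_ge_zero])
      have "norm (f u x - f z x) \<le> 4 / r * w x * norm (u - z)"
      proof (rule field_differentiable_bound[where f = "\<lambda>u. f u x" and f' = "deriv (\<lambda>u. f u x)"
              and S = "ball z (r/2)"])
        fix v assume v: "v \<in> ball z (r/2)"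
        have sub: "cball v (r/4) \<subseteq> ball z r"
        proof
          fix y assume "y \<in> cball v (r/4)"
          then have "dist z y \<le> dist z v + dist v y" "dist v y \<le> r/4" by (auto intro: dist_triangle)
          then show "y \<in> ball z r" using v r by auto
        qed
        have holx: "(\<lambda>u. f u x) holomorphic_on A" using hol x by blast
        have vA: "v \<in> A" using sub r by force
        show "((\<lambda>u. f u x) has_field_derivative deriv (\<lambda>u. f u x) v) (at v within ball z (r/2))"
          using holomorphic_derivI[OF holx A vA] has_field_derivative_at_within by blast
        have "norm ((deriv ^^ 1) (\<lambda>u. f u x) v) \<le> fact 1 * w x / (r/4) ^ 1"
        proof (rule Cauchy_inequality)
          show "(\<lambda>u. f u x) holomorphic_on ball v (r/4)"
            using sub r by (intro holomorphic_on_subset[OF holx]) force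
          show "continuous_on (cball v (r/4)) (\<lambda>u. f u x)"
            using sub r by (intro continuous_on_subset[OF holomorphic_on_imp_continuous_on[OF holx]]) auto
          show "norm (f y x) \<le> w x" if "norm (v - y) = r/4" for y
            using that sub x by (intro bd) (auto simp: dist_norm subset_iff)
        qed (use r in auto)
        then show "norm (deriv (\<lambda>u. f u x) v) \<le> 4 / r * w x" by (simp add: field_simps)
      qed (use u r in auto)
      then show ?thesis using u by (simp add: q_def norm_divide field_simps)
    qed
    have limq: "((\<lambda>u. q u x) \<longlongrightarrow> d x) (at z)" if x: "x \<in> space M" for x
      using holomorphic_derivI[OF hol[OF x] A z, of UNIV] x
      by (simp add: q_def d_def has_field_derivative_iff)
    have DCT: "(\<lambda>n. integral\<^sup>L M (q (X n))) \<longlonglongrightarrow> integral\<^sup>L M d"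
      if X: "\<And>n. X n \<in> ball z (r/2) - {z}" "X \<longlonglongrightarrow> z" for X
    proof -
      have XA: "X n \<in> A" for n using X(1)[of n] r by force
      have m: "q (X n) \<in> borel_measurable M" for n
        unfolding q_def using meas[OF XA] meas[OF z] by measurable
      have l: "(\<lambda>n. q (X n) x) \<longlonglongrightarrow> d x" if "x \<in> space M" for x
        using filterlim_compose[OF limq[OF that], of X sequentially] X
        by (auto simp: filterlim_at)
      have dm: "d \<in> borel_measurable M"
        by (rule borel_measurable_LIMSEQ_metric[OF m l])
      show ?thesis
        by (rule integral_dominated_convergence[where w = "\<lambda>x. 4 / r * w x"])
           (use dm m l bdq X w in auto)
    qed
    have "((\<lambda>u. (integral\<^sup>L M (f u) - integral\<^sup>L M (f z)) / (u - z)) \<longlongrightarrow> integral\<^sup>L M d) (at z)"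
      unfolding tendsto_at_iff_sequentially
    proof (intro allI impI)
      fix X :: "nat \<Rightarrow> complex" assume X: "\<forall>i. X i \<in> UNIV - {z}" "X \<longlonglongrightarrow> z"
      have "eventually (\<lambda>n. X n \<in> ball z (r/2)) sequentially"
        using X(2) r by (intro topological_tendstoD) auto
      then obtain N where N: "\<And>n. n \<ge> N \<Longrightarrow> X n \<in> ball z (r/2)"
        by (auto simp: eventually_sequentially)
      have "(\<lambda>n. integral\<^sup>L M (q (X (n + N)))) \<longlonglongrightarrow> integral\<^sup>L M d"
        by (rule DCT) (use X N LIMSEQ_ignore_initial_segment in auto)
      moreover have "integral\<^sup>L M (q (X (n + N))) =
          (integral\<^sup>L M (f (X (n+N))) - integral\<^sup>L M (f z)) / (X (n+N) - z)" for n
      proof -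
        have "X (n + N) \<in> ball z (r/2)" using N[of "n + N"] by simp
        moreover have "ball z (r/2) \<subseteq> A" using r by (auto intro: order_trans[OF _ r(2)])
        ultimately have "X (n + N) \<in> A" by blast
        then show ?thesis unfolding q_def
          by (subst integral_divide_zero) (use int z in simp)
      qed
      ultimately have "(\<lambda>n. (integral\<^sup>L M (f (X (n+N))) - integral\<^sup>L M (f z)) / (X (n+N) - z)) \<longlonglongrightarrow> integral\<^sup>L M d"
        by simp
      then show "((\<lambda>u. (integral\<^sup>L M (f u) - integral\<^sup>L M (f z)) / (u - z)) \<circ> X) \<longlonglongrightarrow> integral\<^sup>L M d"
        unfolding o_def by (rule LIMSEQ_offset)
    qed
    then show ?thesis by (auto simp: has_field_derivative_iff)
  qed
  then show ?thesis
    using A by (auto simp: holomorphic_on_open)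
qed

section \<open>The Beta integral for complex arguments\<close>

abbreviation (input) unit_interval :: "real measure" where
  "unit_interval \<equiv> lebesgue_on {0<..<1}"

lemma integrable_unit_interval_Beta:
  assumes "a > 0" "b > (0::real)"
  shows "integrable unit_interval (\<lambda>t. t powr (a - 1) * (1 - t) powr (b - 1))"
    and "(\<integral>t. t powr (a - 1) * (1 - t) powr (b - 1) \<partial>unit_interval) = Beta a b"
proof -
  let ?f = "\<lambda>t::real. t powr (a - 1) * (1 - t) powr (b - 1)"
  have 1: "(?f has_integral Beta a b) {0<..<1}"
    using has_integral_Beta_real[OF assms] by (simp add: has_integral_Icc_iff_Ioo)
  then have 2: "?f absolutely_integrable_on {0<..<1}"
    by (intro nonnegative_absolutely_integrable_1) (auto simp: has_integral_iff)
  then show "integrable unit_interval ?f"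
    by (simp add: set_integrable_def integrable_restrict_space)
  have "(\<integral>t. ?f t \<partial>unit_interval) = set_lebesgue_integral lebesgue {0<..<1} ?f"
    by (simp add: set_lebesgue_integral_def integral_restrict_space)
  also have "\<dots> = integral {0<..<1} ?f"
    using 2 by (rule set_lebesgue_integral_eq_integral)
  finally show "(\<integral>t. ?f t \<partial>unit_interval) = Beta a b"
    using 1 by (simp add: has_integral_iff)
qed

lemma measurable_unit_interval_continuous:
  fixes f :: "real \<Rightarrow> complex"
  assumes "continuous_on {0<..<1} f"
  shows "f \<in> borel_measurable unit_interval"
  using assms by (intro continuous_imp_measurable_on_sets_lebesgue) auto

lemma continuous_on_of_real_powr:
  fixes g :: "real \<Rightarrow> real" and s :: complex
  assumes "continuous_on A g" "\<And>x. x \<in> A \<Longrightarrow> g x > 0"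
  shows "continuous_on A (\<lambda>x. of_real (g x) powr s)"
  using assms by (intro continuous_intros) (auto simp: complex_nonpos_Reals_iff less_le)

lemma norm_of_real_powr:
  fixes s :: complex
  assumes "x > 0"
  shows "norm (of_real x powr s) = x powr Re s"
  using assms by (simp add: norm_powr_real_powr)

lemma measurable_Beta_integrand:
  "(\<lambda>t. of_real t powr a * of_real (1 - t) powr b :: complex) \<in> borel_measurable unit_interval"
  by (intro measurable_unit_interval_continuous continuous_on_mult continuous_on_of_real_powr)
     (auto intro!: continuous_intros)

lemma norm_Beta_integrand:
  assumes "t \<in> {0<..<1}"
  shows "norm (of_real t powr (a - 1) * of_real (1 - t) powr (b - 1) :: complex) =
           t powr (Re a - 1) * (1 - t) powr (Re b - 1)"
  using assms norm_of_real_powr[of t "a - 1"] norm_of_real_powr[of "1 - t" "b - 1"]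
  by (simp add: norm_mult)

lemma integrable_Beta_complex:
  assumes "Re a > 0" "Re b > 0"
  shows "integrable unit_interval (\<lambda>t. of_real t powr (a - 1) * of_real (1 - t) powr (b - 1) :: complex)"
  by (rule Bochner_Integration.integrable_bound[OF integrable_unit_interval_Beta(1)[OF assms]
        measurable_Beta_integrand], rule AE_I2)
     (use norm_Beta_integrand in auto)

lemma holomorphic_Beta_integral:
  assumes b: "Re b > 0"
  shows "(\<lambda>a. \<integral>t. of_real t powr (a - 1) * of_real (1 - t) powr (b - 1) \<partial>unit_interval)
           holomorphic_on {a. Re a > 0}"
proof (rule holomorphic_on_integral)
  show "open {a. Re a > 0}" by (simp add: open_halfspace_Re_gt)
  show "(\<lambda>a. of_real t powr (a - 1) * of_real (1 - t) powr (b - 1)) holomorphic_on {a. Re a > 0}"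
    if "t \<in> space unit_interval" for t
    using that by (intro holomorphic_intros) auto
  fix a :: complex assume a: "a \<in> {a. Re a > 0}"
  have ball: "Re u > Re a / 2" if "u \<in> ball a (Re a / 2)" for u
  proof -
    have "\<bar>Re (a - u)\<bar> < Re a / 2"
      using that abs_Re_le_cmod[of "a - u"] by (auto simp: dist_norm)
    then show ?thesis unfolding minus_complex.sel by linarith
  qed
  show "\<exists>r>0. \<exists>w. ball a r \<subseteq> {a. Re a > 0} \<and> integrable unit_interval w \<and>
          (\<forall>u\<in>ball a r. \<forall>t\<in>space unit_interval.
            norm (of_real t powr (u - 1) * of_real (1 - t) powr (b - 1) :: complex) \<le> w t)"
  proof (intro exI conjI ballI)
    \<comment> \<open>On (0,1) a power of t decreases in its exponent, and real parts on the ball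
      exceed Re a / 2, so this one exponent dominates the whole ball.\<close>
    show "integrable unit_interval (\<lambda>t. t powr (Re a / 2 - 1) * (1 - t) powr (Re b - 1))"
      using a b by (intro integrable_unit_interval_Beta) auto
    show "ball a (Re a / 2) \<subseteq> {a. Re a > 0}"
      using a ball by fastforce
    fix u t assume u: "u \<in> ball a (Re a / 2)" and "t \<in> space unit_interval"
    then have t: "t \<in> {0<..<1}" by simp
    have "t powr (Re u - 1) \<le> t powr (Re a / 2 - 1)"
      using t ball[OF u] by (intro powr_mono') auto
    then show "norm (of_real t powr (u - 1) * of_real (1 - t) powr (b - 1) :: complex)
        \<le> t powr (Re a / 2 - 1) * (1 - t) powr (Re b - 1)"
      unfolding norm_Beta_integrand[OF t] by (intro mult_right_mono) auto
  qed (use a in auto)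
qed (rule measurable_Beta_integrand)

lemma one_islimpt_halfline:
  "(1::complex) islimpt (of_real ` {0<..} :: complex set)"
  unfolding islimpt_sequential
proof (intro exI conjI allI)
  show "(\<lambda>n. of_real (1 + inverse (real (Suc n))) :: complex) \<longlonglongrightarrow> 1"
  proof -
    have "(\<lambda>n. of_real (1 + inverse (real (Suc n))) :: complex) \<longlonglongrightarrow> of_real (1 + 0)"
      by (intro tendsto_intros LIMSEQ_inverse_real_of_nat)
    then show ?thesis by simp
  qed
  show "of_real (1 + inverse (real (Suc n))) \<in> (of_real ` {0<..} :: complex set) - {1}" for n
  proof -
    have "1 + inverse (real (Suc n)) \<noteq> 1" "1 + inverse (real (Suc n)) > 0"
      using positive_imp_inverse_positive[of "real (Suc n)"] by linarith+
    moreover from this have "of_real (1 + inverse (real (Suc n))) \<noteq> (1::complex)"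
      using of_real_eq_1_iff by blast
    ultimately show ?thesis by blast
  qed
qed

text \<open>The positive reals accumulate at 1 inside the half plane, which suffices for the
  identity theorem. This is how the real Beta integral reaches complex arguments.\<close>

lemma halfplane_identity:
  assumes "f holomorphic_on {z. Re z > 0}" "g holomorphic_on {z. Re z > 0}"
    and "\<And>x. x > 0 \<Longrightarrow> f (of_real x) = g (of_real x)" and "Re z > 0"
  shows "f z = g z"
proof -
  have "f z - g z = 0"
    by (rule analytic_continuation[where f = "\<lambda>z. f z - g z" and S = "{z. Re z > 0}"
          and U = "of_real ` {0<..}" and \<xi> = 1])
       (use assms one_islimpt_halfline in \<open>auto intro!: holomorphic_intros convex_connected
          simp: open_halfspace_Re_gt convex_halfspace_Re_gt\<close>)
  then show ?thesis by simp
qed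

lemma nonpos_Ints_Re: "z \<in> \<int>\<^sub>\<le>\<^sub>0 \<Longrightarrow> Re z \<le> 0"
  by (auto elim!: nonpos_Ints_cases)

lemma holomorphic_Beta_halfplane:
  assumes "Re b > 0"
  shows "(\<lambda>a. Beta a b) holomorphic_on {a::complex. Re a > 0}"
  using assms unfolding Beta_altdef
  by (intro holomorphic_intros) (auto dest: nonpos_Ints_Re)

lemma has_bochner_integral_unit_interval_reflect:
  fixes f :: "real \<Rightarrow> complex"
  shows "has_bochner_integral unit_interval (\<lambda>t. f (1 - t)) I \<longleftrightarrow>
         has_bochner_integral unit_interval f I"
proof -
  have "(\<lambda>t. indicat_real {0<..<1} (1 - t) *\<^sub>R f (1 - t)) =
        (\<lambda>t. indicat_real {0<..<1} t *\<^sub>R f (1 - t))"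
    by (auto simp: fun_eq_iff indicator_def)
  then show ?thesis
    using has_bochner_integral_lebesgue_real_affine_iff
            [of "-1" "\<lambda>t. indicat_real {0<..<1} t *\<^sub>R f t" I 1]
    by (simp add: has_bochner_integral_restrict_space)
qed

lemma integral_unit_interval_reflect:
  fixes f :: "real \<Rightarrow> complex"
  shows "(\<integral>t. f (1 - t) \<partial>unit_interval) = integral\<^sup>L unit_interval f"
  using has_bochner_integral_unit_interval_reflect[of f]
  by (metis has_bochner_integral_iff not_integrable_integral_eq)

text \<open>One variable is continued at a time: with the second argument real, the first is freed
  from the positive reals; the reflection t -> 1 - t exchanges the arguments, and the same
  continuation then frees the other one.\<close>

lemma Beta_integral_complex:
  assumes a: "Re a > 0" and b: "Re b > 0"
  shows "(\<integral>t. of_real t powr (a - 1) * of_real (1 - t) powr (b - 1) \<partial>unit_interval) = Beta a b"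
proof -
  let ?I = "\<lambda>a b. (\<integral>t. of_real t powr (a - 1) * of_real (1 - t) powr (b - 1) \<partial>unit_interval :: complex)"
  have real: "?I (of_real x) (of_real y) = Beta (of_real x) (of_real y)" if "x > 0" "y > 0" for x y
  proof -
    have "?I (of_real x) (of_real y) = (\<integral>t. of_real (t powr (x - 1) * (1 - t) powr (y - 1)) \<partial>unit_interval)"
    proof (intro Bochner_Integration.integral_cong refl)
      fix t :: real assume "t \<in> space unit_interval"
      then show "of_real t powr (of_real x - 1) * of_real (1 - t) powr (of_real y - 1) =
          complex_of_real (t powr (x - 1) * (1 - t) powr (y - 1))"
        using powr_of_real[of t "x - 1"] powr_of_real[of "1 - t" "y - 1"] by simp
    qed
    also have "\<dots> = of_real (Beta x y)"
      by (simp only: integral_complex_of_real integrable_unit_interval_Beta(2)[OF that])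
    finally show ?thesis by (simp add: Beta_complex_of_real)
  qed
  have left: "?I a (of_real y) = Beta a (of_real y)" if "y > 0" "Re a > 0" for a y
    by (rule halfplane_identity[OF holomorphic_Beta_integral holomorphic_Beta_halfplane])
       (use that real in auto)
  have comm: "?I a b = ?I b a" for a b
    using integral_unit_interval_reflect[of "\<lambda>t. of_real t powr (b - 1) * of_real (1 - t) powr (a - 1)"]
    by (simp add: mult.commute)
  have "?I b a = Beta b a"
    by (rule halfplane_identity[OF holomorphic_Beta_integral holomorphic_Beta_halfplane])
       (use a b left[OF _ a] comm[of a] in \<open>auto simp: Beta_commute\<close>)
  then show ?thesis
    using comm[of a b] by (simp add: Beta_commute)
qed

section \<open>Analytic continuation of the Gauss series\<close>

definition slit_plane :: "complex set" where
  "slit_plane = - (complex_of_real ` {1..})"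

lemma slit_plane_Re_Im: "z \<in> slit_plane \<longleftrightarrow> Im z \<noteq> 0 \<or> Re z < 1"
  by (auto simp: slit_plane_def image_iff complex_eq_iff not_less intro!: bexI[of _ "Re z"])

lemma slit_plane_iff: "z \<in> slit_plane \<longleftrightarrow> 1 - z \<notin> \<real>\<^sub>\<le>\<^sub>0"
  by (auto simp: slit_plane_Re_Im complex_nonpos_Reals_iff)

lemma open_slit_plane: "open slit_plane"
proof -
  have "slit_plane = (\<lambda>z. 1 - z) -` (- \<real>\<^sub>\<le>\<^sub>0)" by (auto simp: slit_plane_iff)
  moreover have "open ((\<lambda>z::complex. 1 - z) -` (- \<real>\<^sub>\<le>\<^sub>0))"
    by (intro open_vimage continuous_intros) (simp add: closed_nonpos_Reals_complex open_Compl)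
  ultimately show ?thesis by simp
qed

text \<open>Used twice: it makes the slit plane star-shaped about 0, hence connected, and it keeps 1
  - z s off the branch cut of the power for s in [0,1].\<close>

lemma slit_plane_scale:
  assumes "z \<in> slit_plane" "0 \<le> t" "t \<le> 1"
  shows "z * of_real t \<in> slit_plane"
proof (rule ccontr)
  assume "z * of_real t \<notin> slit_plane"
  then have h: "Im z * t = 0" "Re z * t \<ge> 1"
    by (auto simp: slit_plane_Re_Im)
  then have "t > 0" using assms by (cases "t = 0") auto
  then have "Im z = 0" using h by simp
  moreover have "Re z \<ge> 1"
  proof (rule ccontr)
    assume "\<not> Re z \<ge> 1"
    then have "Re z * t < 1 * t" using \<open>t > 0\<close> by (intro mult_strict_right_mono) auto
    then show False using h assms by linarith
  qed
  ultimately show False using assms(1) by (auto simp: slit_plane_Re_Im)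
qed

lemma connected_slit_plane: "connected slit_plane"
proof (rule starlike_imp_connected)
  have "closed_segment 0 z \<subseteq> slit_plane" if z: "z \<in> slit_plane" for z
  proof
    fix w assume "w \<in> closed_segment 0 z"
    then obtain u where "0 \<le> u" "u \<le> 1" "w = z * of_real u"
      by (auto simp: in_segment scaleR_conv_of_real mult.commute)
    then show "w \<in> slit_plane" using slit_plane_scale[OF z] by simp
  qed
  moreover have "0 \<in> slit_plane" by (simp add: slit_plane_Re_Im)
  ultimately show "starlike slit_plane" unfolding starlike_def by blast
qed

lemma unit_ball_subset_slit_plane: "ball 0 1 \<subseteq> slit_plane"
proof
  fix z :: complex assume "z \<in> ball 0 1"
  then have "Re z < 1" using complex_Re_le_cmod[of z] by simp
  then show "z \<in> slit_plane" by (auto simp: slit_plane_Re_Im)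
qed

lemma slit_plane_identity:
  assumes "f holomorphic_on slit_plane" "g holomorphic_on slit_plane" and "r > 0" "r \<le> 1"
    and "\<And>z. norm z < r \<Longrightarrow> f z = g z" and "z \<in> slit_plane"
  shows "f z = g z"
proof (rule analytic_continuation_open[where f = f and g = g and s = "ball 0 r" and s' = slit_plane])
  show "ball 0 r \<subseteq> slit_plane"
    using unit_ball_subset_slit_plane subset_ball[OF \<open>r \<le> 1\<close>, of 0] by blast
qed (use assms open_slit_plane connected_slit_plane in auto)

section \<open>The binomial series and integrals against the kernel (1 - z s)^q\<close>

lemma binomial_series:
  fixes p z :: complex
  assumes "norm z < 1"
  shows "(\<lambda>k. pochhammer p k / fact k * z ^ k) sums ((1 - z) powr (- p))"
proof -
  have "(\<lambda>k. ((- p) gchoose k) * (- z) ^ k) sums ((1 + (- z)) powr (- p))"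
    using assms by (intro gen_binomial_complex) auto
  moreover have "((- p) gchoose k) * (- z) ^ k = pochhammer p k / fact k * z ^ k" for k
  proof -
    have "(-1) ^ k * (- z) ^ k = z ^ k" by (simp flip: power_mult_distrib)
    then show ?thesis by (simp add: gbinomial_pochhammer mult.commute mult.left_commute)
  qed
  ultimately show ?thesis by simp
qed

lemma summable_norm_binomial_series:
  fixes p :: complex
  assumes "0 \<le> x" "x < 1"
  shows "summable (\<lambda>k. norm (pochhammer p k / fact k) * x ^ k)"
proof -
  obtain y where y: "x < y" "y < 1" using assms dense by blast
  have "summable (\<lambda>k. pochhammer p k / fact k * of_real y ^ k)"
    using binomial_series[of "of_real y" p] y assms by (auto simp: sums_iff)
  from powser_insidea[OF this, of "of_real x"] show ?thesis
    using y assms by (simp add: norm_mult norm_power norm_divide)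
qed

lemma integrable_mult_bounded:
  fixes f g :: "real \<Rightarrow> complex"
  assumes "integrable M f" "g \<in> borel_measurable M" "\<And>x. x \<in> space M \<Longrightarrow> norm (g x) \<le> B"
  shows "integrable M (\<lambda>x. f x * g x)"
proof (rule Bochner_Integration.integrable_bound)
  show "integrable M (\<lambda>x. B * norm (f x))" using assms(1) by simp
  show "(\<lambda>x. f x * g x) \<in> borel_measurable M"
    using borel_measurable_integrable[OF assms(1)] assms(2) by measurable
  show "AE x in M. norm (f x * g x) \<le> norm (B * norm (f x))"
  proof (rule AE_I2)
    fix x assume "x \<in> space M"
    from assms(3)[OF this] have "norm (g x) * norm (f x) \<le> B * norm (f x)"
      by (intro mult_right_mono) auto
    then show "norm (f x * g x) \<le> norm (B * norm (f x))"
      by (simp add: norm_mult mult.commute)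
  qed
qed

text \<open>Since |s^k| <= 1, the absolutely convergent coefficient series times |\<phi>| is a
  majorant, for any integrable weight. It is applied to the Beta weight in Euler's integral and to
  the hypergeometric weight of the final integrals.\<close>

lemma integral_binomial_series:
  fixes \<phi> :: "real \<Rightarrow> complex" and p z :: complex
  assumes phi: "integrable unit_interval \<phi>" and z: "norm z < 1"
  shows "(\<lambda>k. pochhammer p k / fact k * z ^ k * (\<integral>s. \<phi> s * of_real s ^ k \<partial>unit_interval)) sums
           (\<integral>s. \<phi> s * (1 - z * of_real s) powr (- p) \<partial>unit_interval)"
proof -
  let ?c = "\<lambda>k. pochhammer p k / fact k * z ^ k"
  let ?f = "\<lambda>k s. ?c k * (\<phi> s * of_real s ^ k)"
  have zs: "norm (z * of_real s) < 1" if "s \<in> {0<..<1}" for s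
  proof -
    have "norm z * \<bar>s\<bar> \<le> 1 * \<bar>s\<bar>" using z by (intro mult_right_mono) auto
    also have "1 * \<bar>s\<bar> < 1" using that by auto
    finally show ?thesis unfolding norm_mult norm_of_real .
  qed
  have int: "integrable unit_interval (\<lambda>s. \<phi> s * of_real s ^ k)" for k
    using phi
    by (rule integrable_mult_bounded[where B = 1])
       (auto simp: norm_power power_le_one intro!: measurable_unit_interval_continuous continuous_intros)
  have sm: "summable (\<lambda>k. norm (?c k))"
    using summable_norm_binomial_series[of "norm z" p] z by (simp add: norm_mult norm_power norm_divide)
  have bd: "norm (?f k s) \<le> norm (?c k) * norm (\<phi> s)" if "s \<in> {0<..<1}" for k s
  proof -
    have "norm (\<phi> s) * \<bar>s\<bar> ^ k \<le> norm (\<phi> s) * 1"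
      using that by (intro mult_left_mono power_le_one) auto
    then have "norm (?c k) * (norm (\<phi> s) * \<bar>s\<bar> ^ k) \<le> norm (?c k) * norm (\<phi> s)"
      by (intro mult_left_mono) auto
    then show ?thesis by (simp only: norm_mult norm_power norm_of_real)
  qed
  have "(\<lambda>k. integral\<^sup>L unit_interval (?f k)) sums (\<integral>s. (\<Sum>k. ?f k s) \<partial>unit_interval)"
  proof (rule sums_integral)
    show "integrable unit_interval (?f k)" for k using int by simp
    show "AE s in unit_interval. summable (\<lambda>k. norm (?f k s))"
    proof (rule AE_I2)
      fix s assume "s \<in> space unit_interval"
      then have "s \<in> {0<..<1}" by simp
      from bd[OF this] show "summable (\<lambda>k. norm (?f k s))"
        by (intro summable_comparison_test'[OF summable_mult2[OF sm, of "norm (\<phi> s)"]]) simp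
    qed
    show "summable (\<lambda>k. \<integral>s. norm (?f k s) \<partial>unit_interval)"
    proof (rule summable_comparison_test'[OF summable_mult2[OF sm, of "\<integral>s. norm (\<phi> s) \<partial>unit_interval"]])
      fix k
      have "(\<integral>s. norm (?f k s) \<partial>unit_interval) \<le> (\<integral>s. norm (?c k) * norm (\<phi> s) \<partial>unit_interval)"
        using int phi bd by (intro integral_mono) (auto simp del: norm_mult)
      then show "norm (\<integral>s. norm (?f k s) \<partial>unit_interval) \<le> norm (?c k) * (\<integral>s. norm (\<phi> s) \<partial>unit_interval)"
        by simp
    qed
  qed
  also have "(\<lambda>k. integral\<^sup>L unit_interval (?f k)) = (\<lambda>k. ?c k * (\<integral>s. \<phi> s * of_real s ^ k \<partial>unit_interval))"
    by simp
  also have "(\<integral>s. (\<Sum>k. ?f k s) \<partial>unit_interval) = (\<integral>s. \<phi> s * (1 - z * of_real s) powr (- p) \<partial>unit_interval)"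
  proof (intro Bochner_Integration.integral_cong refl)
    fix s assume "s \<in> space unit_interval"
    then have "s \<in> {0<..<1}" by simp
    from sums_mult[OF binomial_series[OF zs[OF this], of p], of "\<phi> s"]
    have "(\<lambda>k. ?f k s) sums (\<phi> s * (1 - z * of_real s) powr (- p))"
      by (simp add: power_mult_distrib mult_ac)
    then show "(\<Sum>k. ?f k s) = \<phi> s * (1 - z * of_real s) powr (- p)" by (simp add: sums_iff)
  qed
  finally show ?thesis .
qed

lemma continuous_on_powr_const:
  fixes g :: "'a::topological_space \<Rightarrow> complex"
  assumes "continuous_on A g" "\<And>x. x \<in> A \<Longrightarrow> g x \<notin> \<real>\<^sub>\<le>\<^sub>0"
  shows "continuous_on A (\<lambda>x. g x powr q)"
proof -
  have "continuous_on A (\<lambda>x. exp (q * Ln (g x)))"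
    using assms by (intro continuous_intros) auto
  moreover have "g x powr q = exp (q * Ln (g x))" if "x \<in> A" for x
    using assms(2)[OF that] by (auto simp: powr_def)
  ultimately show ?thesis using continuous_on_cong by (metis (no_types, lifting))
qed

lemma kernel_not_nonpos_Real:
  "z \<in> slit_plane \<Longrightarrow> s \<in> {0..1} \<Longrightarrow> 1 - z * of_real s \<notin> \<real>\<^sub>\<le>\<^sub>0"
  using slit_plane_scale[of z s] by (simp add: slit_plane_iff)

text \<open>Continuity on the compact product of \<open>K\<close> with the closed interval gives the
  bound. A one-point \<open>K\<close> serves integrability, a closed disc the local domination
  behind holomorphy.\<close>

lemma bounded_kernel_slit_plane:
  fixes q :: complex
  assumes K: "compact K" "K \<subseteq> slit_plane"
  obtains B where "\<And>z s. z \<in> K \<Longrightarrow> s \<in> {0..1} \<Longrightarrow> norm ((1 - z * of_real s) powr q) \<le> B"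
proof -
  have "compact ((\<lambda>(z, s). (1 - z * of_real s) powr q) ` (K \<times> {0..1::real}))"
  proof (rule compact_continuous_image)
    show "continuous_on (K \<times> {0..1::real}) (\<lambda>(z, s). (1 - z * of_real s) powr q)"
      unfolding case_prod_unfold using kernel_not_nonpos_Real K(2)
      by (intro continuous_on_powr_const continuous_intros) auto
    show "compact (K \<times> {0..1::real})" using K by (intro compact_Times) auto
  qed
  then obtain B where "\<forall>x\<in>(\<lambda>(z, s). (1 - z * of_real s) powr q) ` (K \<times> {0..1::real}). norm x \<le> B"
    using compact_imp_bounded bounded_iff by blast
  then show ?thesis by (intro that[of B]) auto
qed

lemma measurable_kernel_slit_plane:
  assumes "z \<in> slit_plane"
  shows "(\<lambda>s. (1 - z * of_real s) powr q) \<in> borel_measurable unit_interval"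
  using kernel_not_nonpos_Real[OF assms]
  by (intro measurable_unit_interval_continuous continuous_on_powr_const continuous_intros) auto

lemma integrable_kernel_slit_plane:
  assumes "integrable unit_interval \<phi>" "z \<in> slit_plane"
  shows "integrable unit_interval (\<lambda>s. \<phi> s * (1 - z * of_real s) powr q)"
proof -
  obtain B where "\<And>w s. w \<in> {z} \<Longrightarrow> s \<in> {0..1} \<Longrightarrow> norm ((1 - w * of_real s) powr q) \<le> B"
    using bounded_kernel_slit_plane[of "{z}"] assms(2) by auto
  then show ?thesis
    by (intro integrable_mult_bounded[where B = B] measurable_kernel_slit_plane assms) auto
qed

lemma holomorphic_integral_kernel:
  assumes phi: "integrable unit_interval \<phi>"
  shows "(\<lambda>z. \<integral>s. \<phi> s * (1 - z * of_real s) powr q \<partial>unit_interval) holomorphic_on slit_plane"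
proof (rule holomorphic_on_integral[OF open_slit_plane])
  show "(\<lambda>z. \<phi> s * (1 - z * of_real s) powr q) holomorphic_on slit_plane"
    if "s \<in> space unit_interval" for s
    using that kernel_not_nonpos_Real by (intro holomorphic_intros) auto
  show "(\<lambda>s. \<phi> s * (1 - z * of_real s) powr q) \<in> borel_measurable unit_interval" if "z \<in> slit_plane" for z
    using integrable_kernel_slit_plane[OF phi that] by simp
  fix z assume z: "z \<in> slit_plane"
  then obtain r where r: "r > 0" "cball z r \<subseteq> slit_plane"
    using open_slit_plane open_contains_cball by blast
  obtain B where B: "\<And>w s. w \<in> cball z r \<Longrightarrow> s \<in> {0..1} \<Longrightarrow> norm ((1 - w * of_real s) powr q) \<le> B"
    using bounded_kernel_slit_plane[of "cball z r"] r by auto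
  show "\<exists>r>0. \<exists>w. ball z r \<subseteq> slit_plane \<and> integrable unit_interval w \<and>
          (\<forall>u\<in>ball z r. \<forall>s\<in>space unit_interval. norm (\<phi> s * (1 - u * of_real s) powr q) \<le> w s)"
  proof (intro exI conjI ballI)
    show "integrable unit_interval (\<lambda>s. norm (\<phi> s) * B)" using phi by simp
    show "norm (\<phi> s * (1 - u * of_real s) powr q) \<le> norm (\<phi> s) * B"
      if "u \<in> ball z r" "s \<in> space unit_interval" for u s
      unfolding norm_mult using that B[of u s] by (intro mult_left_mono) auto
  qed (use r ball_subset_cball[of z r] in auto)
qed

section \<open>Existence of the continuation: Euler's integral and contiguous relations\<close>

definition hyp_coeff :: "complex \<Rightarrow> complex \<Rightarrow> complex \<Rightarrow> nat \<Rightarrow> complex" where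
  "hyp_coeff a b c n = pochhammer a n * pochhammer b n / (pochhammer c n * fact n)"

text \<open>Solvability of the condition in the choice that defines \<open>hyp2F1\<close>, isolated
  as a predicate of the parameters so that it can be proved by induction along parameter
  shifts.\<close>

definition hyp_extends :: "complex \<Rightarrow> complex \<Rightarrow> complex \<Rightarrow> bool" where
  "hyp_extends a b c \<longleftrightarrow> (\<exists>f. f holomorphic_on slit_plane \<and>
     (\<forall>z. norm z < 1 \<longrightarrow> (\<lambda>n. hyp_coeff a b c n * z ^ n) sums f z))"

lemma Beta_add_of_nat_left:
  fixes a b :: "'a::Gamma"
  assumes "a \<notin> \<int>\<^sub>\<le>\<^sub>0" "a + b \<notin> \<int>\<^sub>\<le>\<^sub>0"
  shows "Beta (a + of_nat k) b = pochhammer a k / pochhammer (a + b) k * Beta a b"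
proof -
  have "Gamma (a + of_nat k) = pochhammer a k * Gamma a"
    "Gamma (a + b + of_nat k) = pochhammer (a + b) k * Gamma (a + b)"
    using assms by (simp_all add: pochhammer_Gamma Gamma_eq_zero_iff)
  then show ?thesis by (simp add: Beta_def add_ac)
qed

lemma of_real_powr_mult_power:
  fixes s :: complex
  assumes "t > 0"
  shows "of_real t powr s * of_real t ^ k = of_real t powr (s + of_nat k)"
  using assms by (simp add: powr_add powr_nat)

text \<open>The normalised moments of the Beta weight are (b)_k / (c)_k, exactly the factor that
  turns the binomial series of (1 - z s)^(-a) into the Gauss series.\<close>

lemma hyp_extends_Euler_integral:
  assumes b: "Re b > 0" and cb: "Re (c - b) > 0"
  shows "hyp_extends a b c"
proof -
  let ?\<phi> = "\<lambda>s. of_real s powr (b - 1) * of_real (1 - s) powr (c - b - 1) :: complex"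
  have phi: "integrable unit_interval ?\<phi>" by (rule integrable_Beta_complex[OF b cb])
  have nz: "Beta b (c - b) \<noteq> 0"
    using b cb nonpos_Ints_Re[of b] nonpos_Ints_Re[of "c - b"] nonpos_Ints_Re[of c]
    by (auto simp: Beta_altdef Gamma_eq_zero_iff rGamma_eq_zero_iff)
  define f where "f z = inverse (Beta b (c - b)) * (\<integral>s. ?\<phi> s * (1 - z * of_real s) powr (- a) \<partial>unit_interval)" for z
  have "f holomorphic_on slit_plane"
    unfolding f_def by (intro holomorphic_intros holomorphic_integral_kernel phi)
  moreover have "(\<lambda>n. hyp_coeff a b c n * z ^ n) sums f z" if z: "norm z < 1" for z
  proof -
    have mom: "(\<integral>s. ?\<phi> s * of_real s ^ k \<partial>unit_interval) = pochhammer b k / pochhammer c k * Beta b (c - b)" for k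
    proof -
      have "(\<integral>s. ?\<phi> s * of_real s ^ k \<partial>unit_interval) =
          (\<integral>s. of_real s powr (b + of_nat k - 1) * of_real (1 - s) powr (c - b - 1) \<partial>unit_interval)"
      proof (intro Bochner_Integration.integral_cong refl)
        fix s :: real assume "s \<in> space unit_interval"
        then have *: "of_real s powr (b - 1) * of_real s ^ k = of_real s powr (b + of_nat k - 1)"
          by (subst of_real_powr_mult_power) (auto simp: algebra_simps)
        then show "?\<phi> s * of_real s ^ k = of_real s powr (b + of_nat k - 1) * of_real (1 - s) powr (c - b - 1)"
          by (simp add: mult_ac flip: *)
      qed
      also have "\<dots> = Beta (b + of_nat k) (c - b)"
        using b cb by (intro Beta_integral_complex) auto
      finally show ?thesis
        using Beta_add_of_nat_left[of b "c - b" k] b cb nonpos_Ints_Re[of b] nonpos_Ints_Re[of c] by auto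
    qed
    have "inverse (Beta b (c - b)) * (pochhammer a k / fact k * z ^ k *
        (pochhammer b k / pochhammer c k * Beta b (c - b))) = hyp_coeff a b c k * z ^ k" for k
      using nz by (simp add: hyp_coeff_def divide_simps)
    with sums_mult[OF integral_binomial_series[OF phi z, of a], of "inverse (Beta b (c - b))"]
    show ?thesis by (simp only: f_def mom)
  qed
  ultimately show ?thesis unfolding hyp_extends_def by blast
qed

text \<open>For the functions the coefficient hypothesis reads F'' = F + \<kappa> z F', and the
  right-hand side is holomorphic wherever F and F' are.\<close>

lemma hyp_extends_combine:
  assumes ext: "hyp_extends a b c" "hyp_extends a' b' c'"
    and coeff0: "hyp_coeff a'' b'' c'' 0 = hyp_coeff a b c 0"
    and coeff: "\<And>n. hyp_coeff a'' b'' c'' (Suc n) = hyp_coeff a b c (Suc n) + \<kappa> * hyp_coeff a' b' c' n"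
  shows "hyp_extends a'' b'' c''"
proof -
  obtain f g where f: "f holomorphic_on slit_plane" "\<And>z. norm z < 1 \<Longrightarrow> (\<lambda>n. hyp_coeff a b c n * z ^ n) sums f z"
    and g: "g holomorphic_on slit_plane" "\<And>z. norm z < 1 \<Longrightarrow> (\<lambda>n. hyp_coeff a' b' c' n * z ^ n) sums g z"
    using ext unfolding hyp_extends_def by auto
  have "(\<lambda>z. f z + \<kappa> * z * g z) holomorphic_on slit_plane"
    using f g by (intro holomorphic_intros)
  moreover have "(\<lambda>n. hyp_coeff a'' b'' c'' n * z ^ n) sums (f z + \<kappa> * z * g z)" if z: "norm z < 1" for z
  proof -
    define h where "h n = (case n of 0 \<Rightarrow> 0 | Suc n \<Rightarrow> \<kappa> * z * (hyp_coeff a' b' c' n * z ^ n))" for n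
    have "(\<lambda>n. h (Suc n)) sums (\<kappa> * z * g z)"
      unfolding h_def using sums_mult[OF g(2)[OF z], of "\<kappa> * z"] by simp
    then have "h sums (\<kappa> * z * g z)" by (subst (asm) sums_Suc_iff) (simp add: h_def)
    from sums_add[OF f(2)[OF z] this]
    have "(\<lambda>n. hyp_coeff a b c n * z ^ n + h n) sums (f z + \<kappa> * z * g z)" .
    moreover have "hyp_coeff a b c n * z ^ n + h n = hyp_coeff a'' b'' c'' n * z ^ n" for n
      by (cases n) (simp_all add: h_def coeff coeff0 algebra_simps)
    ultimately show ?thesis by simp
  qed
  ultimately show ?thesis unfolding hyp_extends_def by (intro exI conjI) auto
qed

lemma pochhammer_nonzero:
  "(c :: complex) \<notin> \<int>\<^sub>\<le>\<^sub>0 \<Longrightarrow> pochhammer c n \<noteq> 0"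
  using pochhammer_eq_0_imp_nonpos_Int by blast

lemma nonpos_Ints_plus_one: "(c :: complex) \<notin> \<int>\<^sub>\<le>\<^sub>0 \<Longrightarrow> c + 1 \<notin> \<int>\<^sub>\<le>\<^sub>0"
  using plus_one_in_nonpos_Ints_imp by blast

text \<open>In both terms on the right, lower minus second upper parameter is c - b + 1, so
  iteration reaches Re (c - b) > 0. As functions: F(a,b;c) = F(a,b;c+1) + ab/(c(c+1)) z
  F(a+1,b+1;c+2).\<close>

lemma hyp_coeff_raise_c:
  assumes c: "c \<notin> \<int>\<^sub>\<le>\<^sub>0"
  shows "hyp_coeff a b c (Suc n) =
           hyp_coeff a b (c + 1) (Suc n) + a * b / (c * (c + 1)) * hyp_coeff (a + 1) (b + 1) (c + 2) n"
proof -
  have c1: "c + 1 \<notin> \<int>\<^sub>\<le>\<^sub>0" using c by (rule nonpos_Ints_plus_one)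
  have c2: "c + 2 \<notin> \<int>\<^sub>\<le>\<^sub>0" using nonpos_Ints_plus_one[OF c1] by (simp add: add.assoc)
  have nz: "c \<noteq> 0" "c + 1 \<noteq> 0" "pochhammer (c + 1) n \<noteq> 0" "pochhammer (c + 2) n \<noteq> 0"
    "1 + of_nat n \<noteq> (0::complex)"
    using of_nat_neq_0[of n, where ?'a = complex] c c1 c2 pochhammer_nonzero by auto
  have "pochhammer (c + 1) (Suc n) \<noteq> 0" using c1 pochhammer_nonzero by blast
  then have nz2: "c + 1 + of_nat n \<noteq> 0" by (simp add: pochhammer_Suc)
  have "(c + 1) * pochhammer (c + 2) n = pochhammer (c + 1) n * (c + 1 + of_nat n)"
    using pochhammer_rec[of "c + 1" n] pochhammer_Suc[of "c + 1" n] by (simp add: add.assoc)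
  then have e: "pochhammer (c + 2) n = pochhammer (c + 1) n * (c + 1 + of_nat n) / (c + 1)"
    using nz by (simp add: field_simps)
  show ?thesis
    unfolding hyp_coeff_def e pochhammer_rec[of a] pochhammer_rec[of b] pochhammer_rec[of c]
      pochhammer_Suc[of "c + 1"] using nz nz2
    by (simp add: divide_simps) (simp add: algebra_simps)
qed

text \<open>Here both terms on the right have second parameter b + 1. As functions: F(a,b;c) =
  F(a,b+1;c) - (a/c) z F(a+1,b+1;c+1).\<close>

lemma hyp_coeff_raise_b:
  assumes c: "c \<notin> \<int>\<^sub>\<le>\<^sub>0"
  shows "hyp_coeff a b c (Suc n) =
           hyp_coeff a (b + 1) c (Suc n) + (- a / c) * hyp_coeff (a + 1) (b + 1) (c + 1) n"
proof -
  have nz: "c \<noteq> 0" "pochhammer (c + 1) n \<noteq> 0" "1 + of_nat n \<noteq> (0::complex)"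
    using of_nat_neq_0[of n, where ?'a = complex] c nonpos_Ints_plus_one[OF c] pochhammer_nonzero by auto
  show ?thesis
    unfolding hyp_coeff_def pochhammer_rec[of a] pochhammer_rec[of b] pochhammer_rec[of c]
      pochhammer_Suc[of "b + 1"] using nz
    by (simp add: divide_simps) (simp add: algebra_simps)
qed

text \<open>The two contiguous relations move the parameters into the range
  \<open>Re c > Re b > 0\<close> of Euler's integral.\<close>

lemma hyp_extends:
  assumes c: "c \<notin> \<int>\<^sub>\<le>\<^sub>0"
  shows "hyp_extends a b c"
proof -
  \<comment> \<open>Re b is already positive here, and \<open>m\<close> bounds the number of unit
    steps that bring c - b into the right half plane.\<close>
  have pos: "hyp_extends a b c" if "Re b > 0" "c \<notin> \<int>\<^sub>\<le>\<^sub>0" "Re (c - b) > - real m" for a b c m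
    using that
  proof (induction m arbitrary: a b c)
    case 0
    then show ?case by (intro hyp_extends_Euler_integral) auto
  next
    case (Suc m)
    have c1: "c + 1 \<notin> \<int>\<^sub>\<le>\<^sub>0" using Suc.prems by (intro nonpos_Ints_plus_one)
    have c2: "c + 2 \<notin> \<int>\<^sub>\<le>\<^sub>0" using nonpos_Ints_plus_one[OF c1] by (simp add: add.assoc)
    show ?case
    proof (rule hyp_extends_combine)
      show "hyp_extends a b (c + 1)" using Suc.prems c1 by (intro Suc.IH) auto
      show "hyp_extends (a + 1) (b + 1) (c + 2)" using Suc.prems c2 by (intro Suc.IH) auto
      show "hyp_coeff a b c (Suc n) = hyp_coeff a b (c + 1) (Suc n) +
          a * b / (c * (c + 1)) * hyp_coeff (a + 1) (b + 1) (c + 2) n" for n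
        using Suc.prems by (intro hyp_coeff_raise_c)
    qed (simp add: hyp_coeff_def)
  qed
  \<comment> \<open>Now \<open>m\<close> bounds the number of steps that make Re b positive. Raising
    b lowers c - b in one of the two terms, which the base case repairs by calling
    \<open>pos\<close> with a large enough \<open>k\<close>.\<close>
  have "hyp_extends a b c" if "c \<notin> \<int>\<^sub>\<le>\<^sub>0" "Re b > - real m" for a b c m
    using that
  proof (induction m arbitrary: a b c)
    case 0
    obtain k where "real k > - Re (c - b)" using reals_Archimedean2 by blast
    then show ?case using 0 by (intro pos[of b c k]) auto
  next
    case (Suc m)
    show ?case
    proof (rule hyp_extends_combine)
      show "hyp_extends a (b + 1) c" using Suc.prems by (intro Suc.IH) auto
      show "hyp_extends (a + 1) (b + 1) (c + 1)"
        using Suc.prems nonpos_Ints_plus_one by (intro Suc.IH) auto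
      show "hyp_coeff a b c (Suc n) = hyp_coeff a (b + 1) c (Suc n) +
          (- a / c) * hyp_coeff (a + 1) (b + 1) (c + 1) n" for n
        using Suc.prems by (intro hyp_coeff_raise_b)
    qed (simp add: hyp_coeff_def)
  qed
  moreover obtain m where "real m > - Re b" using reals_Archimedean2 by blast
  ultimately show ?thesis using c by (metis minus_less_iff)
qed

lemma hyp2F1_spec:
  assumes "c \<notin> \<int>\<^sub>\<le>\<^sub>0"
  shows hyp2F1_holomorphic: "hyp2F1 a b c holomorphic_on slit_plane"
    and hyp2F1_sums: "norm z < 1 \<Longrightarrow> (\<lambda>n. hyp_coeff a b c n * z ^ n) sums hyp2F1 a b c z"
proof -
  let ?P = "\<lambda>f. f holomorphic_on slit_plane \<and>
     (\<forall>z. norm z < 1 \<longrightarrow> (\<lambda>n. hyp_coeff a b c n * z ^ n) sums f z)"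
  have "hyp2F1 a b c = (SOME f. ?P f)" unfolding hyp2F1_def hyp_coeff_def slit_plane_def ..
  moreover have "?P (SOME f. ?P f)"
    using hyp_extends[OF assms, of a b] unfolding hyp_extends_def by (rule someI_ex)
  ultimately have "?P (hyp2F1 a b c)" by simp
  then show "hyp2F1 a b c holomorphic_on slit_plane"
    "norm z < 1 \<Longrightarrow> (\<lambda>n. hyp_coeff a b c n * z ^ n) sums hyp2F1 a b c z" by blast+
qed

lemma hyp2F1_commute: "hyp2F1 a b c = hyp2F1 b a c"
  unfolding hyp2F1_def by (simp add: mult.commute)

section \<open>Gauss's summation theorem\<close>

text \<open>The ratio of the Pochhammer symbol to n! n^z is the classical sequence converging to
  1/Gamma(z), for every complex z, hence is bounded. Its product has n + 1 factors, which explains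
  \<open>Suc n\<close>.\<close>

lemma norm_pochhammer_le_powr:
  fixes z :: complex
  obtains B where "B > 0" "\<And>n. n > 0 \<Longrightarrow> norm (pochhammer z (Suc n)) \<le> B * (fact n * real n powr Re z)"
proof -
  have "Bseq (rGamma_series z)"
    using rGamma_series_LIMSEQ[of z] convergent_imp_Bseq convergentI by blast
  then obtain B where B: "B > 0" "\<And>n. norm (rGamma_series z n) \<le> B" by (auto elim: BseqE)
  show ?thesis
  proof (rule that[OF B(1)])
    fix n :: nat assume n: "n > 0"
    have "norm (rGamma_series z n) = norm (pochhammer z (Suc n)) / (fact n * real n powr Re z)"
      using n by (simp add: rGamma_series_def norm_divide norm_mult powr_def del: pochhammer_Suc)
    moreover have "fact n * real n powr Re z > 0" using n by simp
    ultimately show "norm (pochhammer z (Suc n)) \<le> B * (fact n * real n powr Re z)"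
      using B(2)[of n] by (simp add: pos_divide_le_eq)
  qed
qed

text \<open>The opposite estimate, from the bounded sequence converging to Gamma(d); it controls
  denominators.\<close>

lemma powr_le_pochhammer:
  fixes d :: real
  assumes "d > 0"
  obtains B where "B > 0" "\<And>n. n > 0 \<Longrightarrow> fact n * real n powr d \<le> B * pochhammer d (Suc n)"
proof -
  have "Bseq (Gamma_series d)"
    using Gamma_series_LIMSEQ[of d] convergent_imp_Bseq convergentI by blast
  then obtain B where B: "B > 0" "\<And>n. norm (Gamma_series d n) \<le> B" by (auto elim: BseqE)
  show ?thesis
  proof (rule that[OF B(1)])
    fix n :: nat assume n: "n > 0"
    have "pochhammer d (Suc n) > 0" using assms by (rule pochhammer_pos)
    moreover from this have "norm (Gamma_series d n) = fact n * real n powr d / pochhammer d (Suc n)"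
      using n by (simp add: Gamma_series_def powr_def abs_mult del: pochhammer_Suc)
    ultimately show "fact n * real n powr d \<le> B * pochhammer d (Suc n)"
      using B(2)[of n] by (simp add: pos_divide_le_eq)
  qed
qed

text \<open>With a positive real lower parameter d, one series dominates the Gauss series at 1 for
  all c with Re c >= d simultaneously; it also dominates the norms of the termwise Beta
  integrals.\<close>

definition hyp_majorant :: "complex \<Rightarrow> complex \<Rightarrow> real \<Rightarrow> nat \<Rightarrow> real" where
  "hyp_majorant a b d n = norm (pochhammer a n) * norm (pochhammer b n) / (pochhammer d n * fact n)"

lemma hyp_majorant_nonneg: "d > 0 \<Longrightarrow> hyp_majorant a b d n \<ge> 0"
  using pochhammer_pos[of d n] by (simp add: hyp_majorant_def)

lemma hyp_majorant_le_powr: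
  assumes d: "d > 0"
  obtains B where "B > 0"
    "\<And>n. n > 0 \<Longrightarrow> hyp_majorant a b d (Suc n) \<le> B * real n powr (Re a + Re b - d - 1)"
proof -
  obtain A where A: "A > 0" "\<And>n. n > 0 \<Longrightarrow> norm (pochhammer a (Suc n)) \<le> A * (fact n * real n powr Re a)"
    using norm_pochhammer_le_powr[of a] by blast
  obtain B where B: "B > 0" "\<And>n. n > 0 \<Longrightarrow> norm (pochhammer b (Suc n)) \<le> B * (fact n * real n powr Re b)"
    using norm_pochhammer_le_powr[of b] by blast
  obtain D where D: "D > 0" "\<And>n. n > 0 \<Longrightarrow> fact n * real n powr d \<le> D * pochhammer d (Suc n)"
    using powr_le_pochhammer[OF d] by blast
  show ?thesis
  proof (rule that[of "A * B * D"])
    fix n :: nat assume n: "n > 0"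
    define N where "N = real n"
    have N: "N > 0" using n by (simp add: N_def)
    have den: "pochhammer d (Suc n) * fact (Suc n) \<ge> (fact n * N powr d / D) * (N * fact n)"
    proof (intro mult_mono)
      show "fact n * N powr d / D \<le> pochhammer d (Suc n)"
        using D(2)[OF n] D(1) by (simp add: N_def pos_divide_le_eq mult.commute)
      show "N * fact n \<le> fact (Suc n)" by (simp add: N_def)
    qed (use d N pochhammer_pos[of d "Suc n"] in auto)
    have "hyp_majorant a b d (Suc n) \<le>
        (A * (fact n * N powr Re a)) * (B * (fact n * N powr Re b)) / ((fact n * N powr d / D) * (N * fact n))"
      unfolding hyp_majorant_def
    proof (rule frac_le)
      show "norm (pochhammer a (Suc n)) * norm (pochhammer b (Suc n)) \<le>
          (A * (fact n * N powr Re a)) * (B * (fact n * N powr Re b))"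
        using A B n by (intro mult_mono) (auto simp: N_def)
      show "0 < fact n * N powr d / D * (N * fact n)" using N D(1) by simp
    qed (use A B den in auto)
    also have "\<dots> = A * B * D * (N powr Re a * N powr Re b / (N powr d * N powr 1))"
      using N D(1) by (simp add: divide_simps)
    also have "N powr Re a * N powr Re b / (N powr d * N powr 1) = N powr (Re a + Re b - (d + 1))"
      by (simp only: powr_add powr_diff)
    finally show "hyp_majorant a b d (Suc n) \<le> A * B * D * real n powr (Re a + Re b - d - 1)"
      by (simp add: N_def diff_diff_add)
  qed (use A B D in simp)
qed

lemma summable_hyp_majorant:
  assumes d: "d > 0" and abd: "Re a + Re b < d"
  shows "summable (hyp_majorant a b d)"
proof -
  obtain B where B: "B > 0"
    "\<And>n. n > 0 \<Longrightarrow> hyp_majorant a b d (Suc n) \<le> B * real n powr (Re a + Re b - d - 1)"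
    using hyp_majorant_le_powr[OF d] by blast
  have "summable (\<lambda>n. B * real n powr (Re a + Re b - d - 1))"
    using abd by (intro summable_mult) (simp add: summable_real_powr_iff)
  then have "summable (\<lambda>n. hyp_majorant a b d (Suc n))"
    by (rule summable_comparison_test'[where N = 1]) (use B hyp_majorant_nonneg[OF d] in auto)
  then show ?thesis by (simp add: summable_Suc_iff)
qed

text \<open>This makes the boundary term of the telescoping sum in \<open>hyp_sum_contiguous\<close>
  vanish.\<close>

lemma hyp_majorant_decay:
  assumes d: "d > 0" and abd: "Re a + Re b < d"
  shows "(\<lambda>n. real n * hyp_majorant a b d n) \<longlonglongrightarrow> 0"
proof -
  obtain B where B: "B > 0"
    "\<And>n. n > 0 \<Longrightarrow> hyp_majorant a b d (Suc n) \<le> B * real n powr (Re a + Re b - d - 1)"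
    using hyp_majorant_le_powr[OF d] by blast
  have "(\<lambda>n. real (Suc n) * hyp_majorant a b d (Suc n)) \<longlonglongrightarrow> 0"
  proof (rule tendsto_sandwich[OF _ _ tendsto_const])
    have "((\<lambda>n. real n powr (Re a + Re b - d)) \<longlongrightarrow> 0) sequentially"
      using abd by (intro tendsto_neg_powr filterlim_real_sequentially) auto
    from tendsto_mult[OF tendsto_const[of "2 * B"] this]
    show "(\<lambda>n. 2 * B * real n powr (Re a + Re b - d)) \<longlonglongrightarrow> 0" by simp
    show "\<forall>\<^sub>F n in sequentially. real (Suc n) * hyp_majorant a b d (Suc n) \<le> 2 * B * real n powr (Re a + Re b - d)"
    proof (rule eventually_mono[OF eventually_gt_at_top[of 0]])
      fix n :: nat assume n: "n > 0"
      \<comment> \<open>The factor 2 absorbs n + 1 <= 2 n.\<close>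
      have "real (Suc n) * hyp_majorant a b d (Suc n) \<le> (2 * real n) * (B * real n powr (Re a + Re b - d - 1))"
        using n B hyp_majorant_nonneg[OF d] by (intro mult_mono) auto
      also have "\<dots> = 2 * B * (real n powr 1 * real n powr (Re a + Re b - d - 1))"
        using n by simp
      also have "real n powr 1 * real n powr (Re a + Re b - d - 1) = real n powr (Re a + Re b - d)"
        by (simp only: powr_add[symmetric]) (simp add: algebra_simps)
      finally show "real (Suc n) * hyp_majorant a b d (Suc n) \<le> 2 * B * real n powr (Re a + Re b - d)" .
    qed
    show "\<forall>\<^sub>F n in sequentially. 0 \<le> real (Suc n) * hyp_majorant a b d (Suc n)"
      using hyp_majorant_nonneg[OF d] by simp
  qed
  then show ?thesis by (subst (asm) filterlim_sequentially_Suc)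
qed

lemma pochhammer_Re_le_norm:
  assumes "0 < d" "d \<le> Re c"
  shows "pochhammer d n \<le> norm (pochhammer c n)"
  unfolding pochhammer_prod prod_norm[symmetric]
proof (rule prod_mono)
  fix i assume "i \<in> {0..<n}"
  have "d + real i \<le> Re (c + of_nat i)" using assms by simp
  also have "\<dots> \<le> norm (c + of_nat i)" by (rule complex_Re_le_cmod)
  finally show "0 \<le> d + of_nat i \<and> d + of_nat i \<le> norm (c + of_nat i)" using assms by simp
qed

lemma norm_hyp_coeff_le_majorant:
  assumes "0 < d" "d \<le> Re c"
  shows "norm (hyp_coeff a b c n) \<le> hyp_majorant a b d n"
proof -
  have "pochhammer d n > 0" "pochhammer d n \<le> norm (pochhammer c n)"
    using pochhammer_Re_le_norm[OF assms] pochhammer_pos[OF assms(1)] by auto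
  moreover from this have "norm (pochhammer c n) > 0" by linarith
  ultimately show ?thesis
    unfolding hyp_coeff_def hyp_majorant_def norm_mult norm_divide
    by (intro divide_left_mono mult_mono mult_pos_pos) auto
qed

lemma summable_norm_hyp_coeff:
  assumes "Re c > 0" "Re a + Re b < Re c"
  shows "summable (\<lambda>n. norm (hyp_coeff a b c n))"
  by (rule summable_comparison_test'[OF summable_hyp_majorant[OF assms]])
     (use norm_hyp_coeff_le_majorant[OF assms(1) order_refl] in auto)

text \<open>The termwise form of Gauss's contiguous relation c(c-a-b) F(a,b;c;1) = (c-a)(c-b)
  F(a,b;c+1;1): the two sides differ by a telescoping series built from c n u_n, where u_n is the
  Gauss coefficient.\<close>

lemma hyp_coeff_telescope:
  assumes c: "c \<notin> \<int>\<^sub>\<le>\<^sub>0"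
  shows "c * (c - a - b) * hyp_coeff a b c n - (c - a) * (c - b) * hyp_coeff a b (c + 1) n =
           c * of_nat n * hyp_coeff a b c n - c * of_nat (Suc n) * hyp_coeff a b c (Suc n)"
proof -
  have nz: "c \<noteq> 0" "pochhammer c n \<noteq> 0" "1 + of_nat n \<noteq> (0::complex)"
    using of_nat_neq_0[of n, where ?'a = complex] c pochhammer_nonzero by auto
  have "pochhammer c (Suc n) \<noteq> 0" using c pochhammer_nonzero by blast
  then have nz2: "c + of_nat n \<noteq> 0" by (simp add: pochhammer_Suc)
  have e: "pochhammer (c + 1) n = pochhammer c n * (c + of_nat n) / c"
    using pochhammer_rec[of c n] pochhammer_Suc[of c n] nz by (simp add: field_simps)
  define P where "P = pochhammer a n * pochhammer b n / (pochhammer c n * fact n)"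
  have 1: "hyp_coeff a b c n = P" by (simp add: hyp_coeff_def P_def)
  have 2: "hyp_coeff a b (c + 1) n = P * c / (c + of_nat n)"
    unfolding hyp_coeff_def P_def e using nz nz2 by (simp add: divide_simps)
  have 3: "hyp_coeff a b c (Suc n) = P * (a + of_nat n) * (b + of_nat n) / ((c + of_nat n) * of_nat (Suc n))"
    unfolding hyp_coeff_def P_def using nz nz2 by (simp add: pochhammer_Suc divide_simps)
  have 4: "c * of_nat (Suc n) * hyp_coeff a b c (Suc n) =
        c * (P * (a + of_nat n) * (b + of_nat n) / (c + of_nat n))"
    unfolding 3 using nz by (simp add: divide_simps)
  show ?thesis unfolding 4 1 2
    using nz2 by (simp add: divide_simps) (simp add: algebra_simps)
qed

lemma hyp_sum_contiguous:
  assumes c: "Re c > 0" and abc: "Re a + Re b < Re c"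
  shows "c * (c - a - b) * (\<Sum>n. hyp_coeff a b c n) = (c - a) * (c - b) * (\<Sum>n. hyp_coeff a b (c + 1) n)"
proof -
  have c': "c \<notin> \<int>\<^sub>\<le>\<^sub>0" using c nonpos_Ints_Re[of c] by auto
  have s1: "summable (hyp_coeff a b c)"
    using summable_norm_hyp_coeff[OF assms] by (rule summable_norm_cancel)
  have s2: "summable (hyp_coeff a b (c + 1))"
    by (rule summable_norm_cancel, rule summable_norm_hyp_coeff) (use assms in auto)
  define v where "v n = c * of_nat n * hyp_coeff a b c n" for n
  have "v \<longlonglongrightarrow> 0"
  proof (rule Lim_null_comparison)
    from tendsto_mult[OF tendsto_const[of "norm c"] hyp_majorant_decay[OF assms]]
    show "(\<lambda>n. norm c * (real n * hyp_majorant a b (Re c) n)) \<longlonglongrightarrow> 0" by simp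
    show "\<forall>\<^sub>F n in sequentially. norm (v n) \<le> norm c * (real n * hyp_majorant a b (Re c) n)"
      unfolding v_def norm_mult mult.assoc norm_of_nat
      using norm_hyp_coeff_le_majorant[OF c order_refl] by (intro always_eventually allI mult_left_mono) auto
  qed
  then have "(\<lambda>n. v n - v (Suc n)) sums (v 0 - 0)" by (rule telescope_sums')
  moreover have "v n - v (Suc n) = c * (c - a - b) * hyp_coeff a b c n - (c - a) * (c - b) * hyp_coeff a b (c + 1) n" for n
    unfolding v_def using hyp_coeff_telescope[OF c', of a b n] by simp
  ultimately have sums0: "(\<lambda>n. c * (c - a - b) * hyp_coeff a b c n - (c - a) * (c - b) * hyp_coeff a b (c + 1) n) sums 0"
    by (simp add: v_def)
  have "(\<lambda>n. c * (c - a - b) * hyp_coeff a b c n - (c - a) * (c - b) * hyp_coeff a b (c + 1) n) sums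
      (c * (c - a - b) * (\<Sum>n. hyp_coeff a b c n) - (c - a) * (c - b) * (\<Sum>n. hyp_coeff a b (c + 1) n))"
    using s1 s2 by (intro sums_diff sums_mult summable_sums)
  from sums_unique2[OF this sums0] show ?thesis by simp
qed

text \<open>The relation is kept free of quotients because c - a or c - b may be a nonpositive
  integer.\<close>

lemma hyp_sum_shift:
  assumes c: "Re c > 0" and abc: "Re a + Re b < Re c"
  shows "pochhammer c m * pochhammer (c - a - b) m * (\<Sum>n. hyp_coeff a b c n) =
         pochhammer (c - a) m * pochhammer (c - b) m * (\<Sum>n. hyp_coeff a b (c + of_nat m) n)"
proof (induction m)
  case (Suc m)
  let ?S = "\<lambda>m. \<Sum>n. hyp_coeff a b (c + of_nat m) n"
  have *: "(c + of_nat m) * (c + of_nat m - a - b) * ?S m =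
        (c + of_nat m - a) * (c + of_nat m - b) * ?S (Suc m)"
    using hyp_sum_contiguous[of "c + of_nat m" a b] assms by (simp add: ac_simps)
  have "pochhammer c (Suc m) * pochhammer (c - a - b) (Suc m) * (\<Sum>n. hyp_coeff a b c n) =
      (c + of_nat m) * (c + of_nat m - a - b) * (pochhammer c m * pochhammer (c - a - b) m * (\<Sum>n. hyp_coeff a b c n))"
    by (simp add: pochhammer_Suc algebra_simps)
  also have "\<dots> = pochhammer (c - a) m * pochhammer (c - b) m * ((c + of_nat m) * (c + of_nat m - a - b) * ?S m)"
    by (subst Suc.IH) (simp only: mult_ac)
  also have "\<dots> = pochhammer (c - a) (Suc m) * pochhammer (c - b) (Suc m) * ?S (Suc m)"
    unfolding * by (simp add: pochhammer_Suc algebra_simps)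
  finally show ?case .
qed simp

text \<open>As the lower parameter grows, every coefficient with n > 0 tends to 0 and only the
  leading 1 survives. Tannery's theorem applies because \<open>hyp_majorant\<close> at d = Re c
  bounds all the shifted series.\<close>

lemma hyp_sum_tendsto_one:
  assumes c: "Re c > 0" and abc: "Re a + Re b < Re c"
  shows "(\<lambda>m. \<Sum>n. hyp_coeff a b (c + of_nat m) n) \<longlonglongrightarrow> 1"
proof -
  have lim: "(\<lambda>m. hyp_coeff a b (c + of_nat m) n) \<longlonglongrightarrow> (if n = 0 then 1 else 0)" for n
  proof -
    have inv: "(\<lambda>m. inverse (c + of_nat m + of_nat i)) \<longlonglongrightarrow> 0" for i
    proof -
      have "filterlim (\<lambda>m. (c + of_nat i) + of_nat m) at_infinity sequentially"
        by (intro tendsto_add_filterlim_at_infinity[OF tendsto_const] tendsto_of_nat)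
      from tendsto_inverse_0[THEN filterlim_compose, OF this] show ?thesis
        by (simp add: ac_simps)
    qed
    have "(\<lambda>m. pochhammer a n * pochhammer b n / fact n * (\<Prod>i<n. inverse (c + of_nat m + of_nat i)))
        \<longlonglongrightarrow> pochhammer a n * pochhammer b n / fact n * (\<Prod>i<n. 0)"
      by (intro tendsto_intros inv)
    moreover have "pochhammer a n * pochhammer b n / fact n * (\<Prod>i<n. inverse (c + of_nat m + of_nat i)) =
        hyp_coeff a b (c + of_nat m) n" for m
      using prod_inversef[of "\<lambda>i. c + of_nat m + of_nat i" "{..<n}"]
      by (simp add: hyp_coeff_def pochhammer_prod o_def divide_inverse atLeast0LessThan)
    ultimately have "(\<lambda>m. hyp_coeff a b (c + of_nat m) n)
        \<longlonglongrightarrow> pochhammer a n * pochhammer b n / fact n * (\<Prod>i<n. 0)" by (simp only:)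
    also have "pochhammer a n * pochhammer b n / fact n * (\<Prod>i<n. 0) = (if n = 0 then 1 else 0)"
      by (simp add: power_0_left)
    finally show ?thesis .
  qed
  have "((\<lambda>m. \<Sum>n. hyp_coeff a b (c + of_nat m) n) \<longlongrightarrow> (\<Sum>n. if n = 0 then 1 else 0)) sequentially"
  proof (rule tannerys_theorem[THEN conjunct2, THEN conjunct2])
    show "summable (hyp_majorant a b (Re c))" by (rule summable_hyp_majorant[OF assms])
    show "\<forall>\<^sub>F (n, m) in at_top \<times>\<^sub>F sequentially. norm (hyp_coeff a b (c + of_nat m) n) \<le> hyp_majorant a b (Re c) n"
      using c by (intro always_eventually) (auto intro!: norm_hyp_coeff_le_majorant)
  qed (use lim in auto)
  also have "(\<Sum>n. if n = 0 then 1 else 0 :: complex) = 1"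
    using suminf_finite[of "{0}" "\<lambda>n. if n = 0 then 1 else 0 :: complex"] by simp
  finally show ?thesis .
qed

theorem Gauss_sum:
  assumes c: "Re c > 0" and abc: "Re a + Re b < Re c"
  shows "(\<Sum>n. hyp_coeff a b c n) = Gamma c * Gamma (c - a - b) * rGamma (c - a) * rGamma (c - b)"
proof -
  let ?S = "\<lambda>c. \<Sum>n. hyp_coeff a b c n"
  \<comment> \<open>Dividing the shifted identity by factorials and powers of m turns Pochhammer
    symbols into the sequences converging to 1/Gamma. The powers of m cancel because c + (c - a - b)
    = (c - a) + (c - b).\<close>
  have eq: "rGamma_series c m * rGamma_series (c - a - b) m * ?S c =
      rGamma_series (c - a) m * rGamma_series (c - b) m * ?S (c + of_nat (Suc m))" for m
  proof -
    define L where "L = complex_of_real (ln (of_nat m))"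
    have "exp (c * L) * exp ((c - a - b) * L) = exp ((c - a) * L) * exp ((c - b) * L)"
      by (simp add: algebra_simps flip: exp_add)
    then show ?thesis
      using hyp_sum_shift[OF assms, of "Suc m"]
      by (simp add: rGamma_series_def L_def[symmetric] divide_simps del: pochhammer_Suc)
  qed
  have "(\<lambda>m. ?S (c + of_nat (Suc m))) \<longlonglongrightarrow> 1"
    using hyp_sum_tendsto_one[OF assms] by (rule LIMSEQ_Suc)
  then have lim1: "(\<lambda>m. rGamma_series (c - a) m * rGamma_series (c - b) m * ?S (c + of_nat (Suc m)))
      \<longlonglongrightarrow> rGamma (c - a) * rGamma (c - b) * 1"
    by (intro tendsto_mult rGamma_series_LIMSEQ)
  have "(\<lambda>m. rGamma_series c m * rGamma_series (c - a - b) m * ?S c)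
      \<longlonglongrightarrow> rGamma c * rGamma (c - a - b) * ?S c"
    by (intro tendsto_mult rGamma_series_LIMSEQ tendsto_const)
  from LIMSEQ_unique[OF this lim1[folded eq]]
  have *: "rGamma c * rGamma (c - a - b) * ?S c = rGamma (c - a) * rGamma (c - b)" by simp
  have "Gamma c * Gamma (c - a - b) * (rGamma (c - a) * rGamma (c - b)) =
      (Gamma c * rGamma c) * (Gamma (c - a - b) * rGamma (c - a - b)) * ?S c"
    unfolding *[symmetric] by (simp only: mult_ac)
  moreover have "Gamma c \<noteq> 0" "Gamma (c - a - b) \<noteq> 0"
    using assms nonpos_Ints_Re[of c] nonpos_Ints_Re[of "c - a - b"] by (auto simp: Gamma_eq_zero_iff)
  then have "Gamma c * rGamma c = 1" "Gamma (c - a - b) * rGamma (c - a - b) = 1"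
    by (simp_all add: rGamma_inverse_Gamma)
  ultimately show ?thesis by (simp add: mult.assoc)
qed

section \<open>Euler-type integrals, Pfaff's and Euler's transformations\<close>

lemma not_nonpos_Ints_Re_pos: "Re z > 0 \<Longrightarrow> z \<notin> \<int>\<^sub>\<le>\<^sub>0"
  using nonpos_Ints_Re[of z] by auto

text \<open>Termwise Beta integrals replace (\<gamma>)_n in the denominator by (\<gamma> +
  \<delta>)_n, so the value is Beta \<gamma> \<delta> times a Gauss series at 1, whose convergence
  condition is the last hypothesis.\<close>

theorem has_integral_hyp2F1_Beta:
  assumes g: "Re \<gamma> > 0" and d: "Re \<delta> > 0" and s: "Re (\<gamma> + \<delta> - \<alpha> - \<beta>) > 0"
  shows "has_bochner_integral unit_interval
           (\<lambda>t. of_real t powr (\<gamma> - 1) * of_real (1 - t) powr (\<delta> - 1) * hyp2F1 \<alpha> \<beta> \<gamma> (of_real t))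
           (Gamma \<gamma> * Gamma \<delta> * Gamma (\<gamma> + \<delta> - \<alpha> - \<beta>) * rGamma (\<gamma> + \<delta> - \<alpha>) * rGamma (\<gamma> + \<delta> - \<beta>))"
proof -
  let ?u = "hyp_coeff \<alpha> \<beta> \<gamma>"
  let ?f = "\<lambda>n t. ?u n * (of_real t powr (\<gamma> + of_nat n - 1) * of_real (1 - t) powr (\<delta> - 1))"
  let ?h = "\<lambda>t. of_real t powr (\<gamma> - 1) * of_real (1 - t) powr (\<delta> - 1) * hyp2F1 \<alpha> \<beta> \<gamma> (of_real t)"
  have g': "\<gamma> \<notin> \<int>\<^sub>\<le>\<^sub>0" using g by (rule not_nonpos_Ints_Re_pos)
  have gd': "\<gamma> + \<delta> \<notin> \<int>\<^sub>\<le>\<^sub>0" using g d by (intro not_nonpos_Ints_Re_pos) simp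
  have f_eq: "?f n t = of_real t powr (\<gamma> - 1) * of_real (1 - t) powr (\<delta> - 1) * (?u n * of_real t ^ n)"
    if "t \<in> {0<..<1}" for n t
  proof -
    have "of_real t powr (\<gamma> + of_nat n - 1) = of_real t powr (\<gamma> - 1) * of_real t ^ n"
      using that by (subst of_real_powr_mult_power) (auto simp: algebra_simps)
    then show ?thesis by (simp only: mult_ac)
  qed
  have int: "integrable unit_interval (?f n)" for n
    using g d by (intro integrable_mult_right integrable_Beta_complex) auto
  have ae: "AE t in unit_interval. summable (\<lambda>n. norm (?f n t))"
  proof (rule AE_I2)
    fix t assume "t \<in> space unit_interval"
    then have t: "t \<in> {0<..<1}" by simp
    then obtain y where y: "t < y" "y < 1" using dense[of t 1] by auto
    have "summable (\<lambda>n. ?u n * of_real y ^ n)"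
      using hyp2F1_sums[OF g', of "of_real y" \<alpha> \<beta>] y t by (auto simp: sums_iff)
    from powser_insidea[OF this, of "of_real t"] y t
    have "summable (\<lambda>n. norm (?u n * of_real t ^ n))" by simp
    from summable_mult[OF this, of "norm (of_real t powr (\<gamma> - 1) * of_real (1 - t) powr (\<delta> - 1) :: complex)"]
    show "summable (\<lambda>n. norm (?f n t))" unfolding f_eq[OF t] norm_mult .
  qed
  \<comment> \<open>The Beta factor contributes (Re \<gamma>)_n / (d)_n with d = Re \<gamma> + Re
    \<delta>, and |(\<gamma>)_n| >= (Re \<gamma>)_n. Hence the norms are bounded by multiples of
    \<open>hyp_majorant\<close> with lower parameter d.\<close>
  have smi: "summable (\<lambda>n. \<integral>t. norm (?f n t) \<partial>unit_interval)"
  proof -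
    let ?d = "Re \<gamma> + Re \<delta>"
    have norm_int: "(\<integral>t. norm (?f n t) \<partial>unit_interval) = norm (?u n) * Beta (Re \<gamma> + real n) (Re \<delta>)" for n
    proof -
      have "(\<integral>t. norm (?f n t) \<partial>unit_interval) =
          (\<integral>t. norm (?u n) * (t powr (Re \<gamma> + real n - 1) * (1 - t) powr (Re \<delta> - 1)) \<partial>unit_interval)"
      proof (intro Bochner_Integration.integral_cong refl)
        fix t assume "t \<in> space unit_interval"
        then have t: "t \<in> {0<..<1}" by simp
        show "norm (?f n t) = norm (?u n) * (t powr (Re \<gamma> + real n - 1) * (1 - t) powr (Re \<delta> - 1))"
          unfolding norm_mult[of "?u n"] norm_Beta_integrand[OF t] by simp
      qed
      also have "\<dots> = norm (?u n) * Beta (Re \<gamma> + real n) (Re \<delta>)"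
        using integrable_unit_interval_Beta[of "Re \<gamma> + real n" "Re \<delta>"] g d by simp
      finally show ?thesis .
    qed
    have "summable (\<lambda>n. hyp_majorant \<alpha> \<beta> ?d n * Beta (Re \<gamma>) (Re \<delta>))"
      using g d s by (intro summable_mult2 summable_hyp_majorant) auto
    then show ?thesis
    proof (rule summable_comparison_test'[where N = 0])
      fix n :: nat
      have pos: "pochhammer (Re \<gamma>) n > 0" "pochhammer ?d n > 0"
        using g d by (auto intro!: pochhammer_pos)
      have ni: "Re \<gamma> \<notin> \<int>\<^sub>\<le>\<^sub>0" "?d \<notin> \<int>\<^sub>\<le>\<^sub>0"
        using g d by (auto elim!: nonpos_Ints_cases)
      have Bpos: "Beta (Re \<gamma>) (Re \<delta>) \<ge> 0"
        using g d by (simp add: Beta_def Gamma_real_pos less_imp_le)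
      have "norm (?u n) * Beta (Re \<gamma> + real n) (Re \<delta>) =
          norm (?u n) * (pochhammer (Re \<gamma>) n / pochhammer ?d n * Beta (Re \<gamma>) (Re \<delta>))"
        using Beta_add_of_nat_left[OF ni, of n] by simp
      also have "\<dots> \<le> hyp_majorant \<alpha> \<beta> (Re \<gamma>) n * (pochhammer (Re \<gamma>) n / pochhammer ?d n * Beta (Re \<gamma>) (Re \<delta>))"
        using norm_hyp_coeff_le_majorant[OF g order_refl] pos Bpos by (intro mult_right_mono) auto
      also have "\<dots> = hyp_majorant \<alpha> \<beta> ?d n * Beta (Re \<gamma>) (Re \<delta>)"
        using pos by (simp add: hyp_majorant_def mult_ac)
      finally show "norm (\<integral>t. norm (?f n t) \<partial>unit_interval) \<le> hyp_majorant \<alpha> \<beta> ?d n * Beta (Re \<gamma>) (Re \<delta>)"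
        unfolding norm_int using g d
        by (simp add: abs_mult Beta_def Gamma_real_pos less_imp_le)
    qed
  qed
  have sum_eq: "(\<Sum>n. ?f n t) = ?h t" if "t \<in> space unit_interval" for t
  proof -
    have t: "t \<in> {0<..<1}" using that by simp
    have "(\<lambda>n. ?u n * of_real t ^ n) sums hyp2F1 \<alpha> \<beta> \<gamma> (of_real t)"
      using t by (intro hyp2F1_sums g') auto
    from sums_mult[OF this, of "of_real t powr (\<gamma> - 1) * of_real (1 - t) powr (\<delta> - 1)"]
    show ?thesis unfolding f_eq[OF t, symmetric] by (rule sums_unique[symmetric])
  qed
  have "integrable unit_interval ?h"
  proof (subst Bochner_Integration.integrable_cong[OF refl sum_eq[symmetric]])
    show "integrable unit_interval (\<lambda>t. \<Sum>n. ?f n t)" by (rule integrable_suminf[OF int ae smi])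
  qed
  moreover have "integral\<^sup>L unit_interval ?h =
      Gamma \<gamma> * Gamma \<delta> * Gamma (\<gamma> + \<delta> - \<alpha> - \<beta>) * rGamma (\<gamma> + \<delta> - \<alpha>) * rGamma (\<gamma> + \<delta> - \<beta>)"
  proof -
    have "integral\<^sup>L unit_interval ?h = (\<integral>t. (\<Sum>n. ?f n t) \<partial>unit_interval)"
      by (intro Bochner_Integration.integral_cong refl sum_eq[symmetric])
    also have "\<dots> = (\<Sum>n. integral\<^sup>L unit_interval (?f n))"
      by (rule integral_suminf[OF int ae smi])
    also have "\<dots> = (\<Sum>n. Beta \<gamma> \<delta> * hyp_coeff \<alpha> \<beta> (\<gamma> + \<delta>) n)"
    proof (rule suminf_cong)
      fix n
      have "integral\<^sup>L unit_interval (?f n) = ?u n * Beta (\<gamma> + of_nat n) \<delta>"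
        using Beta_integral_complex[of "\<gamma> + of_nat n" \<delta>] g d by simp
      also have "\<dots> = Beta \<gamma> \<delta> * hyp_coeff \<alpha> \<beta> (\<gamma> + \<delta>) n"
        using pochhammer_nonzero[OF g', of n]
        by (simp add: Beta_add_of_nat_left[OF g' gd'] hyp_coeff_def mult_ac)
      finally show "integral\<^sup>L unit_interval (?f n) = Beta \<gamma> \<delta> * hyp_coeff \<alpha> \<beta> (\<gamma> + \<delta>) n" .
    qed
    also have "\<dots> = Beta \<gamma> \<delta> * (\<Sum>n. hyp_coeff \<alpha> \<beta> (\<gamma> + \<delta>) n)"
      by (rule suminf_mult, rule summable_norm_cancel, rule summable_norm_hyp_coeff) (use g d s in auto)
    also have "\<dots> = (Gamma (\<gamma> + \<delta>) * rGamma (\<gamma> + \<delta>)) * (Gamma \<gamma> * Gamma \<delta> * Gamma (\<gamma> + \<delta> - \<alpha> - \<beta>) *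
        rGamma (\<gamma> + \<delta> - \<alpha>) * rGamma (\<gamma> + \<delta> - \<beta>))"
      using g d s by (subst Gauss_sum) (auto simp: Beta_altdef)
    also have "Gamma (\<gamma> + \<delta>) * rGamma (\<gamma> + \<delta>) = 1"
      using gd' by (simp add: rGamma_inverse_Gamma Gamma_eq_zero_iff)
    finally show ?thesis by simp
  qed
  ultimately show ?thesis by (simp add: has_bochner_integral_iff)
qed

text \<open>A factor s^k merely moves \<delta> to \<delta> + k, so every Taylor coefficient in
  \<eta> is, after reflection of the interval, an instance of
  \<open>has_integral_hyp2F1_Beta\<close>.\<close>

theorem has_integral_hyp2F1_kernel:
  assumes g: "Re \<gamma> > 0" and d: "Re \<delta> > 0" and s: "Re (\<gamma> + \<delta> - \<alpha> - \<beta>) > 0"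
    and C: "\<gamma> + \<delta> - \<alpha> \<notin> \<int>\<^sub>\<le>\<^sub>0" and \<eta>: "\<eta> \<in> slit_plane"
  shows "has_bochner_integral unit_interval
           (\<lambda>s. of_real s powr (\<delta> - 1) * of_real (1 - s) powr (\<gamma> - 1) * hyp2F1 \<alpha> \<beta> \<gamma> (of_real (1 - s))
                  * (1 - \<eta> * of_real s) powr (- (\<gamma> + \<delta> - \<beta>)))
           (Gamma \<gamma> * Gamma \<delta> * Gamma (\<gamma> + \<delta> - \<alpha> - \<beta>) * rGamma (\<gamma> + \<delta> - \<alpha>) * rGamma (\<gamma> + \<delta> - \<beta>)
              * hyp2F1 (\<gamma> + \<delta> - \<alpha> - \<beta>) \<delta> (\<gamma> + \<delta> - \<alpha>) \<eta>)"
proof -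
  define \<sigma> where "\<sigma> = \<gamma> + \<delta> - \<alpha> - \<beta>"
  define c where "c = \<gamma> + \<delta> - \<alpha>"
  define p where "p = \<gamma> + \<delta> - \<beta>"
  define K where "K = Gamma \<gamma> * Gamma \<delta> * Gamma \<sigma> * rGamma c * rGamma p"
  define \<phi> where "\<phi> s = of_real s powr (\<delta> - 1) * of_real (1 - s) powr (\<gamma> - 1) * hyp2F1 \<alpha> \<beta> \<gamma> (of_real (1 - s))" for s
  have mom: "has_bochner_integral unit_interval (\<lambda>s. \<phi> s * of_real s ^ k)
      (Gamma \<gamma> * Gamma (\<delta> + of_nat k) * Gamma (\<sigma> + of_nat k) * rGamma (c + of_nat k) * rGamma (p + of_nat k))" for k
  proof -
    have "has_bochner_integral unit_interval
           (\<lambda>t. of_real t powr (\<gamma> - 1) * of_real (1 - t) powr (\<delta> + of_nat k - 1) * hyp2F1 \<alpha> \<beta> \<gamma> (of_real t))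
           (Gamma \<gamma> * Gamma (\<delta> + of_nat k) * Gamma (\<sigma> + of_nat k) * rGamma (c + of_nat k) * rGamma (p + of_nat k))"
      using has_integral_hyp2F1_Beta[of \<gamma> "\<delta> + of_nat k" \<alpha> \<beta>] g d s
      by (simp add: \<sigma>_def c_def p_def algebra_simps)
    then have "has_bochner_integral unit_interval
           (\<lambda>s. of_real (1 - s) powr (\<gamma> - 1) * of_real s powr (\<delta> + of_nat k - 1) * hyp2F1 \<alpha> \<beta> \<gamma> (of_real (1 - s)))
           (Gamma \<gamma> * Gamma (\<delta> + of_nat k) * Gamma (\<sigma> + of_nat k) * rGamma (c + of_nat k) * rGamma (p + of_nat k))"
      by (subst (asm) has_bochner_integral_unit_interval_reflect[symmetric]) simp
    also have "?this \<longleftrightarrow> ?thesis"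
    proof (intro has_bochner_integral_cong refl)
      fix s :: real assume "s \<in> space unit_interval"
      then have "of_real s powr (\<delta> + of_nat k - 1) = of_real s powr (\<delta> - 1) * of_real s ^ k"
        by (subst of_real_powr_mult_power) (auto simp: algebra_simps)
      then show "of_real (1 - s) powr (\<gamma> - 1) * of_real s powr (\<delta> + of_nat k - 1) * hyp2F1 \<alpha> \<beta> \<gamma> (of_real (1 - s)) =
          \<phi> s * of_real s ^ k"
        by (simp only: \<phi>_def mult_ac)
    qed
    finally show ?thesis .
  qed
  have phi: "integrable unit_interval \<phi>" using mom[of 0] by (simp add: has_bochner_integral_iff)
  define I where "I z = (\<integral>s. \<phi> s * (1 - z * of_real s) powr (- p) \<partial>unit_interval)" for z
  have c': "c \<notin> \<int>\<^sub>\<le>\<^sub>0" using C by (simp add: c_def)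
  have coeff: "pochhammer p k / fact k * (Gamma \<gamma> * Gamma (\<delta> + of_nat k) * Gamma (\<sigma> + of_nat k) *
      rGamma (c + of_nat k) * rGamma (p + of_nat k)) = K * hyp_coeff \<sigma> \<delta> c k" for k
  proof -
    have 1: "Gamma (\<delta> + of_nat k) = pochhammer \<delta> k * Gamma \<delta>"
      "Gamma (\<sigma> + of_nat k) = pochhammer \<sigma> k * Gamma \<sigma>"
      using not_nonpos_Ints_Re_pos[OF d] not_nonpos_Ints_Re_pos[OF s]
      by (simp_all add: \<sigma>_def[symmetric] pochhammer_Gamma Gamma_eq_zero_iff)
    have 2: "rGamma (c + of_nat k) = rGamma c / pochhammer c k"
      using pochhammer_rGamma[of c k] pochhammer_nonzero[OF c', of k] by simp
    have "pochhammer p k / fact k * (Gamma \<gamma> * Gamma (\<delta> + of_nat k) * Gamma (\<sigma> + of_nat k) *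
      rGamma (c + of_nat k) * rGamma (p + of_nat k)) =
      (pochhammer p k * rGamma (p + of_nat k)) * (Gamma \<gamma> * Gamma \<delta> * Gamma \<sigma> * rGamma c * hyp_coeff \<sigma> \<delta> c k)"
      unfolding 1 2 hyp_coeff_def by (simp add: divide_simps)
    \<comment> \<open>The kernel exponent was chosen for this cancellation, which holds for every p
      because 1/Gamma is entire. It removes the third upper parameter.\<close>
    also have "pochhammer p k * rGamma (p + of_nat k) = rGamma p" by (rule pochhammer_rGamma[symmetric])
    finally show ?thesis by (simp add: K_def)
  qed
  have "I \<eta> = K * hyp2F1 \<sigma> \<delta> c \<eta>"
  proof (rule slit_plane_identity[where r = 1 and f = I and g = "\<lambda>z. K * hyp2F1 \<sigma> \<delta> c z"])
    show "I holomorphic_on slit_plane" unfolding I_def by (rule holomorphic_integral_kernel[OF phi])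
    show "(\<lambda>z. K * hyp2F1 \<sigma> \<delta> c z) holomorphic_on slit_plane"
      by (intro holomorphic_intros hyp2F1_holomorphic c')
    fix z :: complex assume z: "norm z < 1"
    have "(\<lambda>k. pochhammer p k / fact k * z ^ k * (\<integral>s. \<phi> s * of_real s ^ k \<partial>unit_interval)) sums I z"
      unfolding I_def by (rule integral_binomial_series[OF phi z])
    moreover have "pochhammer p k / fact k * z ^ k * (\<integral>s. \<phi> s * of_real s ^ k \<partial>unit_interval) =
        K * (hyp_coeff \<sigma> \<delta> c k * z ^ k)" for k
      using arg_cong[OF coeff[of k], of "\<lambda>u. u * z ^ k"] has_bochner_integral_integral_eq[OF mom[of k]]
      by (simp add: mult_ac)
    moreover have "(\<lambda>k. K * (hyp_coeff \<sigma> \<delta> c k * z ^ k)) sums (K * hyp2F1 \<sigma> \<delta> c z)"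
      by (intro sums_mult hyp2F1_sums c' z)
    ultimately show "I z = K * hyp2F1 \<sigma> \<delta> c z" by (simp add: sums_unique2)
  qed (use \<eta> in auto)
  moreover have "integrable unit_interval (\<lambda>s. \<phi> s * (1 - \<eta> * of_real s) powr (- p))"
    by (rule integrable_kernel_slit_plane[OF phi \<eta>])
  ultimately have "has_bochner_integral unit_interval (\<lambda>s. \<phi> s * (1 - \<eta> * of_real s) powr (- p))
      (K * hyp2F1 \<sigma> \<delta> c \<eta>)"
    by (simp add: has_bochner_integral_iff I_def)
  then show ?thesis unfolding \<phi>_def K_def \<sigma>_def c_def p_def .
qed

section \<open>Pfaff's and Euler's transformations by comparing power series at 0\<close>

lemma fps_mult_compose_nth:
  fixes A F G :: "'a::comm_ring_1 fps"
  assumes "fps_nth G 0 = 0"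
  shows "fps_nth (A * (F oo G)) n = (\<Sum>i\<le>n. fps_nth F i * fps_nth (A * G ^ i) n)"
proof -
  \<comment> \<open>\<open>G\<close> has no constant term, so its i-th power starts in degree i or
    later; the composition can therefore be cut off at n for all m <= n at once.\<close>
  have comp: "fps_nth (F oo G) m = (\<Sum>i\<le>n. fps_nth F i * fps_nth (G ^ i) m)" if "m \<le> n" for m
    unfolding fps_compose_nth atMost_atLeast0
    using that startsby_zero_power_prefix[OF assms] by (intro sum.mono_neutral_left) auto
  have "fps_nth (A * (F oo G)) n = (\<Sum>j\<le>n. fps_nth A j * (\<Sum>i\<le>n. fps_nth F i * fps_nth (G ^ i) (n - j)))"
    unfolding fps_mult_nth atMost_atLeast0 by (intro sum.cong refl) (simp add: comp atMost_atLeast0)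
  also have "\<dots> = (\<Sum>i\<le>n. \<Sum>j\<le>n. fps_nth A j * (fps_nth F i * fps_nth (G ^ i) (n - j)))"
    unfolding sum_distrib_left by (rule sum.swap)
  also have "\<dots> = (\<Sum>i\<le>n. fps_nth F i * fps_nth (A * G ^ i) n)"
    by (simp add: fps_mult_nth atMost_atLeast0 sum_distrib_left mult_ac)
  finally show ?thesis .
qed

text \<open>The expansion of (1 - z)^(-a) at 0.\<close>

definition fps_neg_binomial :: "complex \<Rightarrow> complex fps" where
  "fps_neg_binomial a = Abs_fps (\<lambda>n. pochhammer a n / fact n)"

lemma fps_neg_binomial_shift:
  "fps_neg_binomial a = fps_neg_binomial (a + 1) * (1 - fps_X)"
proof (rule fps_ext)
  fix n
  show "fps_nth (fps_neg_binomial a) n = fps_nth (fps_neg_binomial (a + 1) * (1 - fps_X)) n"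
  proof (cases n)
    case (Suc m)
    have "1 + of_nat m \<noteq> (0::complex)" using of_nat_neq_0[of m, where ?'a = complex] by simp
    then have "pochhammer (a + 1) m / fact m = (1 + of_nat m) * pochhammer (a + 1) m / fact (Suc m)"
      by simp
    then have "pochhammer (a + 1) (Suc m) / fact (Suc m) - pochhammer (a + 1) m / fact m = pochhammer a (Suc m) / fact (Suc m)"
      unfolding pochhammer_rec[of a] pochhammer_Suc[of "a + 1"]
      by (simp add: algebra_simps flip: diff_divide_distrib del: fact_Suc)
    then show ?thesis by (simp add: Suc fps_neg_binomial_def algebra_simps del: fact_Suc)
  qed (simp add: fps_neg_binomial_def)
qed

text \<open>Each factor -X/(1 - X) contributes -X and raises the exponent of 1/(1 - X) by one,
  whence a + i. The coefficients of Pfaff's right-hand side thereby become explicit finite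
  sums.\<close>

lemma fps_neg_binomial_mult_power:
  "fps_neg_binomial a * (- fps_X * inverse (1 - fps_X)) ^ i = fps_const ((-1) ^ i) * (fps_X ^ i * fps_neg_binomial (a + of_nat i))"
proof (induction i arbitrary: a)
  case (Suc i)
  have inv: "(1 - fps_X) * inverse (1 - fps_X) = (1 :: complex fps)"
    by (rule inverse_mult_eq_1') simp
  have "fps_neg_binomial a * (- fps_X * inverse (1 - fps_X)) ^ Suc i =
      (- fps_X) * ((1 - fps_X) * inverse (1 - fps_X)) * (fps_neg_binomial (a + 1) * (- fps_X * inverse (1 - fps_X)) ^ i)"
    by (subst fps_neg_binomial_shift) (simp only: power_Suc mult_ac)
  also have "\<dots> = fps_const ((-1) ^ Suc i) * (fps_X ^ Suc i * fps_neg_binomial (a + of_nat (Suc i)))"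
    unfolding inv Suc.IH by (simp add: add_ac mult_ac flip: fps_const_neg)
  finally show ?case .
qed simp

text \<open>With (-n)_i = (-1)^i n! / (n - i)! and (a)_n = (a)_i (a + i)_(n - i), everything
  involving a leaves the sum; Chu-Vandermonde evaluates the rest, with c - (c - b) = b.\<close>

lemma hyp_coeff_Pfaff:
  assumes c: "c \<notin> \<int>\<^sub>\<le>\<^sub>0"
  shows "(\<Sum>i\<le>n. hyp_coeff a (c - b) c i * ((-1) ^ i * (pochhammer (a + of_nat i) (n - i) / fact (n - i)))) =
           hyp_coeff a b c n"
proof -
  have "hyp_coeff a (c - b) c i * ((-1) ^ i * (pochhammer (a + of_nat i) (n - i) / fact (n - i))) =
      pochhammer a n / fact n * (pochhammer (c - b) i * pochhammer (- of_nat n) i / (of_nat (fact i) * pochhammer c i))"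
    if i: "i \<le> n" for i
  proof -
    have "(-1) ^ i * pochhammer (- of_nat n) i / fact i = (of_nat (n choose i) :: complex)"
      by (simp add: binomial_gbinomial gbinomial_pochhammer)
    also have "\<dots> = fact n / (fact i * fact (n - i))" using i by (rule binomial_fact)
    finally have "(-1) ^ i * pochhammer (- of_nat n) i = (fact n / fact (n - i) :: complex)"
      by (simp add: divide_simps mult_ac)
    then have "((-1) ^ i * (-1) ^ i) * pochhammer (- of_nat n) i = (-1) ^ i * (fact n / fact (n - i) :: complex)"
      by (simp only: mult.assoc)
    then have 1: "pochhammer (- of_nat n) i = (-1) ^ i * (fact n / fact (n - i) :: complex)"
      by (simp flip: power_mult_distrib)
    have 2: "pochhammer a n = pochhammer a i * pochhammer (a + of_nat i) (n - i)"
      using i by (rule pochhammer_product)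
    show ?thesis unfolding hyp_coeff_def 1 2 by (simp add: divide_simps)
  qed
  then have "(\<Sum>i\<le>n. hyp_coeff a (c - b) c i * ((-1) ^ i * (pochhammer (a + of_nat i) (n - i) / fact (n - i)))) =
      pochhammer a n / fact n * (\<Sum>i=0..n. pochhammer (c - b) i * pochhammer (- of_nat n) i / (of_nat (fact i) * pochhammer c i))"
    by (simp add: sum_distrib_left atMost_atLeast0)
  also have "\<forall>i\<in>{0..<n}. c \<noteq> - of_nat i" using c by auto
  from Vandermonde_pochhammer[OF this, of "c - b"]
  have "(\<Sum>i=0..n. pochhammer (c - b) i * pochhammer (- of_nat n) i / (of_nat (fact i) * pochhammer c i)) =
      pochhammer b n / pochhammer c n" by simp
  finally show ?thesis by (simp add: hyp_coeff_def mult_ac)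
qed

text \<open>The substitution z -> z / (z - 1) inverts 1 - z, and inversion preserves the complement
  of the nonpositive reals. Hence Pfaff's substitution maps the slit plane into itself.\<close>

lemma slit_plane_Pfaff:
  assumes "z \<in> slit_plane"
  shows "1 - z / (z - 1) = inverse (1 - z)" "z / (z - 1) \<in> slit_plane" "z \<noteq> 1"
proof -
  show z1: "z \<noteq> 1" using assms by (auto simp: slit_plane_iff)
  then show eq: "1 - z / (z - 1) = inverse (1 - z)" by (simp add: divide_simps)
  show "z / (z - 1) \<in> slit_plane" using assms by (simp add: slit_plane_iff eq)
qed

lemma hyp2F1_has_fps_expansion:
  assumes "c \<notin> \<int>\<^sub>\<le>\<^sub>0"
  shows "hyp2F1 a b c has_fps_expansion Abs_fps (hyp_coeff a b c)"
proof (rule has_fps_expansionI)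
  have "\<forall>\<^sub>F u in nhds 0. u \<in> ball (0::complex) 1" by (intro eventually_nhds_in_open) auto
  then show "\<forall>\<^sub>F u in nhds 0. (\<lambda>n. fps_nth (Abs_fps (hyp_coeff a b c)) n * u ^ n) sums hyp2F1 a b c u"
    by (rule eventually_mono) (use hyp2F1_sums[OF assms] in auto)
qed

lemma powr_has_fps_expansion_neg_binomial:
  "(\<lambda>z. (1 - z) powr (- a)) has_fps_expansion fps_neg_binomial a"
proof (rule has_fps_expansionI)
  have "\<forall>\<^sub>F u in nhds 0. u \<in> ball (0::complex) 1" by (intro eventually_nhds_in_open) auto
  then show "\<forall>\<^sub>F u in nhds 0. (\<lambda>n. fps_nth (fps_neg_binomial a) n * u ^ n) sums (1 - u) powr (- a)"
    by (rule eventually_mono) (use binomial_series in \<open>auto simp: fps_neg_binomial_def\<close>)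
qed

text \<open>Formal series give the equality only near 0. Invariance of the slit plane under the
  substitution makes the right-hand side holomorphic there, so the identity theorem extends
  it.\<close>

theorem hyp2F1_Pfaff:
  assumes c: "c \<notin> \<int>\<^sub>\<le>\<^sub>0" and z: "z \<in> slit_plane"
  shows "hyp2F1 a b c z = (1 - z) powr (- a) * hyp2F1 a (c - b) c (z / (z - 1))"
proof -
  let ?G = "- fps_X * inverse (1 - fps_X) :: complex fps"
  let ?F = "Abs_fps (hyp_coeff a (c - b) c)"
  let ?g = "\<lambda>z. (1 - z) powr (- a) * hyp2F1 a (c - b) c (z / (z - 1))"
  have "(\<lambda>z::complex. - z * inverse (1 - z)) has_fps_expansion ?G"
    by (intro fps_expansion_intros) simp
  moreover have "- z * inverse (1 - z) = z / (z - 1)" for z :: complex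
    by (metis divide_inverse minus_diff_eq minus_divide_divide)
  ultimately have G: "(\<lambda>z. z / (z - 1)) has_fps_expansion ?G" by simp
  have "?g has_fps_expansion fps_neg_binomial a * (?F oo ?G)"
    using has_fps_expansion_mult[OF powr_has_fps_expansion_neg_binomial
        has_fps_expansion_compose[OF hyp2F1_has_fps_expansion[OF c] G]]
    by (simp add: o_def)
  also have "fps_neg_binomial a * (?F oo ?G) = Abs_fps (hyp_coeff a b c)"
  proof (rule fps_ext)
    fix n
    have "fps_nth (fps_neg_binomial a * (?F oo ?G)) n =
        (\<Sum>i\<le>n. hyp_coeff a (c - b) c i * fps_nth (fps_neg_binomial a * ?G ^ i) n)"
      by (subst fps_mult_compose_nth) simp_all
    also have "\<dots> = (\<Sum>i\<le>n. hyp_coeff a (c - b) c i * ((-1) ^ i * (pochhammer (a + of_nat i) (n - i) / fact (n - i))))"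
      unfolding fps_neg_binomial_mult_power
      by (intro sum.cong refl) (simp add: fps_X_power_mult_nth fps_neg_binomial_def)
    also have "\<dots> = fps_nth (Abs_fps (hyp_coeff a b c)) n" using hyp_coeff_Pfaff[OF c] by simp
    finally show "fps_nth (fps_neg_binomial a * (?F oo ?G)) n = fps_nth (Abs_fps (hyp_coeff a b c)) n" .
  qed
  finally have "\<forall>\<^sub>F z in nhds 0. hyp2F1 a b c z = ?g z"
    using hyp2F1_has_fps_expansion[OF c, of a b]
    unfolding has_fps_expansion_def by (auto elim: eventually_elim2)
  then obtain r where r: "r > 0" "\<And>z. norm z < r \<Longrightarrow> hyp2F1 a b c z = ?g z"
    by (auto simp: eventually_nhds_metric)
  show ?thesis
  proof (rule slit_plane_identity[where r = "min r 1" and f = "hyp2F1 a b c" and g = ?g])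
    show "hyp2F1 a b c holomorphic_on slit_plane" by (rule hyp2F1_holomorphic[OF c])
    have "(hyp2F1 a (c - b) c \<circ> (\<lambda>z. z / (z - 1))) holomorphic_on slit_plane"
    proof (rule holomorphic_on_compose_gen)
      show "(\<lambda>z. z / (z - 1)) holomorphic_on slit_plane"
        using slit_plane_Pfaff(3) by (intro holomorphic_intros) auto
      show "hyp2F1 a (c - b) c holomorphic_on slit_plane" by (rule hyp2F1_holomorphic[OF c])
    qed (use slit_plane_Pfaff(2) in auto)
    then show "?g holomorphic_on slit_plane"
      by (intro holomorphic_intros) (auto simp: slit_plane_iff o_def)
  qed (use r z in auto)
qed

text \<open>Pfaff's transformation applied twice, fixing a different upper parameter each time; z ->
  z / (z - 1) is an involution.\<close>

theorem hyp2F1_Euler: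
  assumes c: "c \<notin> \<int>\<^sub>\<le>\<^sub>0" and z: "z \<in> slit_plane"
  shows "hyp2F1 a b c z = (1 - z) powr (c - a - b) * hyp2F1 (c - a) (c - b) c z"
proof -
  define w where "w = z / (z - 1)"
  have w: "w \<in> slit_plane" "1 - w = inverse (1 - z)" "z \<noteq> 1"
    using slit_plane_Pfaff[OF z] by (auto simp: w_def)
  then have wz: "w / (w - 1) = z" by (simp add: w_def divide_simps)
  have "hyp2F1 a b c z = (1 - z) powr (- a) * hyp2F1 (c - b) a c w"
    using hyp2F1_Pfaff[OF c z, of a b] by (simp add: w_def hyp2F1_commute[of a])
  also have "hyp2F1 (c - b) a c w = inverse (1 - z) powr (b - c) * hyp2F1 (c - a) (c - b) c z"
    using hyp2F1_Pfaff[OF c w(1), of "c - b" a] by (simp add: w wz hyp2F1_commute[of "c - b"])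
  \<comment> \<open>The principal logarithm changes sign under inversion off the nonpositive reals,
    and 1 - z lies there for z in the slit plane.\<close>
  also have "inverse (1 - z) powr (b - c) = (1 - z) powr (c - b)"
    using z w by (simp add: powr_def Ln_inverse slit_plane_iff algebra_simps)
  finally have "hyp2F1 a b c z = ((1 - z) powr (- a) * (1 - z) powr (c - b)) * hyp2F1 (c - a) (c - b) c z"
    by (simp only: mult.assoc)
  also have "(1 - z) powr (- a) * (1 - z) powr (c - b) = (1 - z) powr (c - a - b)"
    by (simp add: algebra_simps flip: powr_add)
  finally show ?thesis .
qed

section \<open>Integrals of Kummer's solutions\<close>

text \<open>Written as exponentials, products of complex powers of positive reals are compared
  through linear identities between exponents; the final bookkeeping in both integrals runs this
  way.\<close>

lemma of_real_powr_eq_exp: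
  fixes s :: complex
  assumes "x > 0"
  shows "of_real x powr s = exp (s * of_real (ln x))"
  using assms by (simp add: powr_def Ln_of_real)

lemma of_real_mult_powr:
  fixes s :: complex
  assumes "x > 0" "y > 0"
  shows "of_real (x * y) powr s = of_real x powr s * of_real y powr s"
  using assms by (simp only: of_real_powr_eq_exp mult_pos_pos ln_mult_pos of_real_add distrib_left exp_add)

lemma of_real_in_slit_plane: "x < 1 \<Longrightarrow> of_real x \<in> slit_plane"
  by (simp add: slit_plane_Re_Im)

lemma one_minus_mult_pos:
  fixes x y :: real
  assumes "x < 1" "0 < y" "y < 1"
  shows "1 - x * y > 0"
proof -
  have "x * y < 1 * y" using assms by (intro mult_strict_right_mono) auto
  then show ?thesis using assms by linarith
qed

lemma has_bochner_integral_w\<^sub>5: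
  fixes a b c \<mu> :: complex and x :: real
  assumes s: "Re (- a - \<mu> + 1) > 0" and d: "Re (c - a - \<mu>) > 0" and g: "Re (a + b - c + 1) > 0"
    and C: "b - (a + \<mu>) + 1 \<notin> \<int>\<^sub>\<le>\<^sub>0" and x: "x \<in> {..<0} \<union> {1<..}"
  shows "has_bochner_integral unit_interval
         (\<lambda>y. of_real y powr (c - a - \<mu> - 1) * of_real (1 - y) powr (a + b - c)
              * w\<^sub>5 y a b c * of_real \<bar>x - y\<bar> powr (\<mu> - 1))
         (Gamma (- a - \<mu> + 1) * Gamma (c - a - \<mu>) * Gamma (a + b - c + 1)
            * rGamma (b - a - \<mu> + 1) * rGamma (1 - \<mu>)
            * of_real \<bar>x\<bar> powr (c - a - 1) * of_real \<bar>1 - x\<bar> powr (a + b - c + \<mu>)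
            * w\<^sub>4 x (a + \<mu>) b c)"
proof -
  \<comment> \<open>Read off from the weight: 1 - y and y have exponents \<gamma> - 1 and \<delta> -
    1, and \<gamma> is also the lower parameter in \<open>w\<^sub>5\<close>.\<close>
  define \<gamma> where "\<gamma> = a + b - c + 1"
  define \<delta> where "\<delta> = c - a - \<mu>"
  define C where "C = b - (a + \<mu>) + 1"
  define K where "K = Gamma \<gamma> * Gamma \<delta> * Gamma (1 - a - \<mu>) * rGamma C * rGamma (1 - \<mu>)"
  \<comment> \<open>From |x - y| = |x| (1 - y/x); the value lies below 1 both for x < 0 and for x >
    1.\<close>
  define \<eta> where "\<eta> = inverse x"
  have \<eta>1: "\<eta> < 1" using x by (auto simp: \<eta>_def inverse_less_1_iff)
  have \<eta>: "complex_of_real \<eta> \<in> slit_plane" using \<eta>1 by (rule of_real_in_slit_plane)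
  have x0: "\<bar>x\<bar> > 0" "\<bar>1 - x\<bar> > 0" using x by auto
  have par: "\<gamma> + \<delta> - a - b = 1 - a - \<mu>" "\<gamma> + \<delta> - a = C" "\<gamma> + \<delta> - b = 1 - \<mu>"
    by (simp_all add: \<gamma>_def \<delta>_def C_def)
  have C': "C \<notin> \<int>\<^sub>\<le>\<^sub>0" using C by (simp add: C_def)
  have "has_bochner_integral unit_interval
     (\<lambda>s. of_real s powr (\<delta> - 1) * of_real (1 - s) powr (\<gamma> - 1) * hyp2F1 a b \<gamma> (of_real (1 - s))
            * (1 - of_real \<eta> * of_real s) powr (- (1 - \<mu>)))
     (K * hyp2F1 (1 - a - \<mu>) \<delta> C (of_real \<eta>))"
    unfolding K_def
    by (rule has_integral_hyp2F1_kernel[of \<gamma> \<delta> a b "of_real \<eta>", unfolded par(1), unfolded par(2,3)])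
       (use s d g \<eta> C' in \<open>auto simp: \<gamma>_def \<delta>_def\<close>)
  from has_bochner_integral_mult_right[OF this, of "of_real \<bar>x\<bar> powr (\<mu> - 1)"]
  have "has_bochner_integral unit_interval
     (\<lambda>s. of_real \<bar>x\<bar> powr (\<mu> - 1) * (of_real s powr (\<delta> - 1) * of_real (1 - s) powr (\<gamma> - 1)
            * hyp2F1 a b \<gamma> (of_real (1 - s)) * (1 - of_real \<eta> * of_real s) powr (- (1 - \<mu>))))
     (of_real \<bar>x\<bar> powr (\<mu> - 1) * (K * hyp2F1 (1 - a - \<mu>) \<delta> C (of_real \<eta>)))" by simp
  also have "?this \<longleftrightarrow> ?thesis"
  proof (intro has_bochner_integral_cong refl)
    fix y assume "y \<in> space unit_interval"
    then have y: "y \<in> {0<..<1}" by simp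
    have pos: "1 - \<eta> * y > 0" using \<eta>1 y by (intro one_minus_mult_pos) auto
    have "\<bar>x - y\<bar> = \<bar>x\<bar> * (1 - \<eta> * y)"
    proof -
      have "x - y = x * (1 - \<eta> * y)" using x0 by (simp add: \<eta>_def field_simps)
      then show ?thesis using pos by (simp add: abs_mult)
    qed
    then have "of_real \<bar>x - y\<bar> powr (\<mu> - 1) = of_real \<bar>x\<bar> powr (\<mu> - 1) * (1 - of_real \<eta> * of_real y) powr (- (1 - \<mu>))"
      using of_real_mult_powr[OF x0(1) pos, of "\<mu> - 1"] by simp
    then show "of_real \<bar>x\<bar> powr (\<mu> - 1) * (of_real y powr (\<delta> - 1) * of_real (1 - y) powr (\<gamma> - 1)
            * hyp2F1 a b \<gamma> (of_real (1 - y)) * (1 - of_real \<eta> * of_real y) powr (- (1 - \<mu>))) =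
        of_real y powr (c - a - \<mu> - 1) * of_real (1 - y) powr (a + b - c)
              * w\<^sub>5 y a b c * of_real \<bar>x - y\<bar> powr (\<mu> - 1)"
      by (simp add: w\<^sub>5_def \<gamma>_def \<delta>_def)
  next
    have "1 - \<eta> = \<bar>1 - x\<bar> / \<bar>x\<bar>"
    proof -
      have "1 - \<eta> = (x - 1) / x" using x0 by (simp add: \<eta>_def divide_simps)
      then have "\<bar>1 - \<eta>\<bar> = \<bar>1 - x\<bar> / \<bar>x\<bar>" by (simp add: abs_divide abs_minus_commute)
      then show ?thesis using \<eta>1 by simp
    qed
    then have "ln (1 - \<eta>) = ln \<bar>1 - x\<bar> - ln \<bar>x\<bar>" using x0 by (simp add: ln_div)
    then have pw: "of_real (1 - \<eta>) powr e = exp (e * (of_real (ln \<bar>1 - x\<bar>) - of_real (ln \<bar>x\<bar>)))" for e :: complex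
      using \<eta>1 by (subst of_real_powr_eq_exp) auto
    \<comment> \<open>The upper parameters obtained are C - b and C - (b - c + 1), while
      \<open>w\<^sub>4\<close> has b and b - c + 1; Euler's transformation exchanges the
      pairs.\<close>
    have "hyp2F1 (1 - a - \<mu>) \<delta> C (of_real \<eta>) =
        (1 - of_real \<eta>) powr (C - (1 - a - \<mu>) - \<delta>) * hyp2F1 (C - (1 - a - \<mu>)) (C - \<delta>) C (of_real \<eta>)"
      by (rule hyp2F1_Euler[OF C' \<eta>])
    also have "\<dots> = of_real (1 - \<eta>) powr (a + b - c + \<mu>) * hyp2F1 b (b - c + 1) C (of_real \<eta>)"
      by (simp add: C_def \<delta>_def algebra_simps)
    finally have F: "hyp2F1 (1 - a - \<mu>) \<delta> C (of_real \<eta>) =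
        of_real (1 - \<eta>) powr (a + b - c + \<mu>) * hyp2F1 b (b - c + 1) C (of_real \<eta>)" .
    define H where "H = hyp2F1 b (b - c + 1) C (of_real \<eta>)"
    define L where "L = complex_of_real (ln \<bar>x\<bar>)"
    define M where "M = complex_of_real (ln \<bar>1 - x\<bar>)"
    have w: "w\<^sub>4 x (a + \<mu>) b c = exp (- b * L) * H"
      unfolding w\<^sub>4_def of_real_powr_eq_exp[OF x0(1)] by (simp add: H_def L_def C_def \<eta>_def)
    have "exp ((\<mu> - 1) * L) * (exp ((a + b - c + \<mu>) * (M - L)) * H) =
        exp ((\<mu> - 1) * L + (a + b - c + \<mu>) * (M - L)) * H"
      by (simp only: exp_add mult_ac)
    also have "(\<mu> - 1) * L + (a + b - c + \<mu>) * (M - L) = (c - a - 1) * L + (a + b - c + \<mu>) * M + - b * L"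
      by (simp add: algebra_simps)
    also have "exp \<dots> * H = exp ((c - a - 1) * L) * exp ((a + b - c + \<mu>) * M) * (exp (- b * L) * H)"
      by (simp only: exp_add mult_ac)
    finally have "of_real \<bar>x\<bar> powr (\<mu> - 1) * hyp2F1 (1 - a - \<mu>) \<delta> C (of_real \<eta>) =
        of_real \<bar>x\<bar> powr (c - a - 1) * of_real \<bar>1 - x\<bar> powr (a + b - c + \<mu>) * w\<^sub>4 x (a + \<mu>) b c"
      unfolding F w pw of_real_powr_eq_exp[OF x0(1)] of_real_powr_eq_exp[OF x0(2)]
        H_def[symmetric] L_def[symmetric] M_def[symmetric] .
    then show "of_real \<bar>x\<bar> powr (\<mu> - 1) * (K * hyp2F1 (1 - a - \<mu>) \<delta> C (of_real \<eta>)) =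
        Gamma (- a - \<mu> + 1) * Gamma (c - a - \<mu>) * Gamma (a + b - c + 1)
            * rGamma (b - a - \<mu> + 1) * rGamma (1 - \<mu>)
            * of_real \<bar>x\<bar> powr (c - a - 1) * of_real \<bar>1 - x\<bar> powr (a + b - c + \<mu>)
            * w\<^sub>4 x (a + \<mu>) b c"
      by (simp add: K_def \<gamma>_def \<delta>_def C_def algebra_simps)
  qed
  finally show ?thesis .
qed

text \<open>The change of variables theorem applied next speaks of absolute integrability together
  with the value of the integral.\<close>

lemma has_bochner_integral_lebesgue_on_iff:
  fixes f :: "real \<Rightarrow> complex"
  assumes "S \<in> sets lebesgue"
  shows "has_bochner_integral (lebesgue_on S) f I \<longleftrightarrow> f absolutely_integrable_on S \<and> integral S f = I"
proof -
  have "has_bochner_integral (lebesgue_on S) f I \<longleftrightarrow> f absolutely_integrable_on S \<and> set_lebesgue_integral lebesgue S f = I"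
    using assms by (subst has_bochner_integral_restrict_space)
      (auto simp: has_bochner_integral_iff set_integrable_def set_lebesgue_integral_def)
  then show ?thesis using set_lebesgue_integral_eq_integral(2)[of S f] by auto
qed

text \<open>The map s -> -s/(1 - s) decreases from 0 to minus infinity on (0,1), has derivative
  -1/(1 - s)^2, and is inverted by y -> -y/(1 - y).\<close>

lemma has_bochner_integral_negative_halfline:
  fixes f :: "real \<Rightarrow> complex"
  shows "has_bochner_integral (lebesgue_on {..<0}) f I \<longleftrightarrow>
         has_bochner_integral unit_interval (\<lambda>s. (1 / (1 - s)\<^sup>2) *\<^sub>R f (- s / (1 - s))) I"
proof -
  let ?g = "\<lambda>s::real. - s / (1 - s)"
  have img: "?g ` {0<..<1} = {..<0}"
  proof (intro equalityI subsetI)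
    fix y :: real assume "y \<in> {..<0}"
    then have "y = ?g (- y / (1 - y))" "- y / (1 - y) \<in> {0<..<1}"
      by (auto simp: divide_simps)
    then show "y \<in> ?g ` {0<..<1}" by blast
  qed (auto simp: divide_simps)
  have S: "{0<..<1::real} \<in> sets lebesgue" "{..<0::real} \<in> sets lebesgue" by auto
  have der: "(?g has_field_derivative - 1 / (1 - s)\<^sup>2) (at s within {0<..<1})" if "s \<in> {0<..<1}" for s
    using that by (auto intro!: derivative_eq_intros simp: power2_eq_square divide_simps)
  have inj: "inj_on ?g {0<..<1}"
    by (auto simp: inj_on_def divide_simps) (simp_all add: algebra_simps)
  have "has_bochner_integral unit_interval (\<lambda>s. \<bar>- 1 / (1 - s)\<^sup>2\<bar> *\<^sub>R f (?g s)) I \<longleftrightarrow>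
      has_bochner_integral (lebesgue_on (?g ` {0<..<1})) f I"
    unfolding img has_bochner_integral_lebesgue_on_iff[OF S(1)] has_bochner_integral_lebesgue_on_iff[OF S(2)]
    using has_absolute_integral_change_of_variables_real[OF S(1) der inj, of f I, unfolded img] .
  then show ?thesis unfolding img by simp
qed

lemma has_bochner_integral_w\<^sub>3:
  fixes a b c \<mu> :: complex and x :: real
  assumes s: "Re (- a - \<mu> + 1) > 0" and d: "Re (c - a - \<mu>) > 0" and g: "Re (a - b + 1) > 0"
    and C: "c - (a + \<mu>) - b + 1 \<notin> \<int>\<^sub>\<le>\<^sub>0" and x: "x \<in> {0<..<1} \<union> {1<..}"
  shows "has_bochner_integral (lebesgue_on {..<0})
         (\<lambda>y. of_real (- y) powr (c - a - \<mu> - 1) * of_real (1 - y) powr (a + b - c)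
              * w\<^sub>3 y a b c * of_real (x - y) powr (\<mu> - 1))
         (Gamma (- a - \<mu> + 1) * Gamma (c - a - \<mu>) * Gamma (a - b + 1)
            * rGamma (c - a - b - \<mu> + 1) * rGamma (1 - \<mu>)
            * of_real x powr (c - a - 1) * of_real \<bar>1 - x\<bar> powr (a + b - c + \<mu>)
            * w\<^sub>6 x (a + \<mu>) b c)"
proof -
  define \<gamma> where "\<gamma> = a - b + 1"
  define \<delta> where "\<delta> = c - a - \<mu>"
  define C where "C = c - (a + \<mu>) - b + 1"
  define K where "K = Gamma \<gamma> * Gamma \<delta> * Gamma (1 - a - \<mu>) * rGamma C * rGamma (1 - \<mu>)"
  \<comment> \<open>Determined by x - y = x (1 - \<eta> s)/(1 - s) for y = -s/(1 - s).\<close>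
  define \<eta> where "\<eta> = 1 - inverse x"
  have x0: "x > 0" "\<bar>1 - x\<bar> > 0" using x by auto
  then have \<eta>1: "\<eta> < 1" by (simp add: \<eta>_def)
  have \<eta>: "complex_of_real \<eta> \<in> slit_plane" using \<eta>1 by (rule of_real_in_slit_plane)
  \<comment> \<open>The second upper parameter is c - b: since 1/y = t/(t - 1) for t = 1 - s,
    Pfaff's transformation relates the series in \<open>w\<^sub>3\<close>, with parameters a and a -
    c + 1, to the one at t with parameters a and c - b.\<close>
  have par: "\<gamma> + \<delta> - a - (c - b) = 1 - a - \<mu>" "\<gamma> + \<delta> - a = C" "\<gamma> + \<delta> - (c - b) = 1 - \<mu>"
    by (simp_all add: \<gamma>_def \<delta>_def C_def)
  have C': "C \<notin> \<int>\<^sub>\<le>\<^sub>0" using C by (simp add: C_def)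
  have \<gamma>': "\<gamma> \<notin> \<int>\<^sub>\<le>\<^sub>0" using g by (intro not_nonpos_Ints_Re_pos) (simp add: \<gamma>_def)
  have "has_bochner_integral unit_interval
     (\<lambda>s. of_real s powr (\<delta> - 1) * of_real (1 - s) powr (\<gamma> - 1) * hyp2F1 a (c - b) \<gamma> (of_real (1 - s))
            * (1 - of_real \<eta> * of_real s) powr (- (1 - \<mu>)))
     (K * hyp2F1 (1 - a - \<mu>) \<delta> C (of_real \<eta>))"
    unfolding K_def
    by (rule has_integral_hyp2F1_kernel[of \<gamma> \<delta> a "c - b" "of_real \<eta>", unfolded par(1), unfolded par(2,3)])
       (use s d g \<eta> C' in \<open>auto simp: \<gamma>_def \<delta>_def\<close>)
  from has_bochner_integral_mult_right[OF this, of "of_real x powr (\<mu> - 1)"]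
  have "has_bochner_integral unit_interval
     (\<lambda>s. of_real x powr (\<mu> - 1) * (of_real s powr (\<delta> - 1) * of_real (1 - s) powr (\<gamma> - 1)
            * hyp2F1 a (c - b) \<gamma> (of_real (1 - s)) * (1 - of_real \<eta> * of_real s) powr (- (1 - \<mu>))))
     (of_real x powr (\<mu> - 1) * (K * hyp2F1 (1 - a - \<mu>) \<delta> C (of_real \<eta>)))" by simp
  also have "?this \<longleftrightarrow> ?thesis"
    unfolding has_bochner_integral_negative_halfline
  proof (intro has_bochner_integral_cong refl)
    fix s assume "s \<in> space unit_interval"
    then have s: "0 < s" "s < 1" by auto
    let ?t = "1 - s"
    let ?y = "- s / ?t"
    have pos: "1 - \<eta> * s > 0" using \<eta>1 s by (rule one_minus_mult_pos)
    define P where "P = ln s"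
    define Q where "Q = ln ?t"
    have my: "- ?y = s / ?t" "\<bar>?y\<bar> = s / ?t" "1 - ?y = 1 / ?t" "inverse ?y = ?t / (?t - 1)"
      using s by (simp_all add: divide_simps abs_div_pos)
    have xy: "x - ?y = x * ((1 - \<eta> * s) / ?t)" using x0 s by (simp add: \<eta>_def field_simps)
    have p1: "of_real (s / ?t) powr e = exp (e * (of_real P - of_real Q))" for e :: complex
      using s by (subst of_real_powr_eq_exp) (auto simp: ln_div P_def Q_def)
    have p2: "of_real (1 / ?t) powr e = exp (e * (- of_real Q))" for e :: complex
      using s by (subst of_real_powr_eq_exp) (auto simp: ln_div Q_def)
    have p3: "of_real s powr e = exp (e * of_real P)" "of_real ?t powr e = exp (e * of_real Q)" for e :: complex
      using s by (simp_all only: of_real_powr_eq_exp P_def Q_def diff_gt_0_iff_gt)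
    have p4: "of_real (x - ?y) powr e = of_real x powr e * (of_real (1 - \<eta> * s) powr e * exp (e * (- of_real Q)))" for e :: complex
      unfolding xy using x0 s pos p2[of e] of_real_mult_powr[of "1 - \<eta> * s" "1 / ?t" e]
      by (subst of_real_mult_powr) auto
    have jac: "of_real (1 / ?t\<^sup>2) = exp (- 2 * of_real Q :: complex)"
    proof -
      have "exp (- 2 * Q) = 1 / ?t\<^sup>2"
        using s by (simp add: Q_def exp_minus exp_double inverse_eq_divide)
      then show ?thesis by (metis exp_of_real of_real_minus of_real_mult of_real_numeral)
    qed
    have "hyp2F1 a (c - b) \<gamma> (of_real ?t) =
        (1 - of_real ?t) powr (- a) * hyp2F1 a (\<gamma> - (c - b)) \<gamma> (of_real ?t / (of_real ?t - 1))"
      using s by (intro hyp2F1_Pfaff \<gamma>' of_real_in_slit_plane) auto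
    also have "\<dots> = exp (- a * of_real P) * hyp2F1 a (a - c + 1) (a - b + 1) (of_real (inverse ?y))"
      unfolding my by (simp add: \<gamma>_def p3 algebra_simps)
    finally have F: "hyp2F1 a (c - b) \<gamma> (of_real ?t) =
        exp (- a * of_real P) * hyp2F1 a (a - c + 1) (a - b + 1) (of_real (inverse ?y))" .
    have k: "(1 - of_real \<eta> * of_real s) powr (- (1 - \<mu>)) = of_real (1 - \<eta> * s) powr (\<mu> - 1)"
      by simp
    define H where "H = hyp2F1 a (a - c + 1) (a - b + 1) (of_real (inverse ?y))"
    define X where "X = of_real x powr (\<mu> - 1)"
    define E where "E = of_real (1 - \<eta> * s) powr (\<mu> - 1)"
    \<comment> \<open>All powers of s and 1 - s are gathered into one exponential, where the
      Jacobian and the factors of the integrand balance as a linear identity in \<open>P\<close> and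
      \<open>Q\<close>.\<close>
    have "X * (exp ((\<delta> - 1) * of_real P) * exp ((\<gamma> - 1) * of_real Q) * (exp (- a * of_real P) * H) * E) =
        X * H * E * exp ((\<delta> - 1) * of_real P + (\<gamma> - 1) * of_real Q + - a * of_real P)"
      by (simp only: exp_add mult_ac)
    also have "(\<delta> - 1) * of_real P + (\<gamma> - 1) * of_real Q + - a * of_real P =
        - 2 * of_real Q + (c - a - \<mu> - 1) * (of_real P - of_real Q) + (a + b - c) * (- of_real Q) +
        (- a) * (of_real P - of_real Q) + (\<mu> - 1) * (- of_real Q)"
      by (simp add: \<gamma>_def \<delta>_def algebra_simps)
    also have "X * H * E * exp \<dots> = exp (- 2 * of_real Q) * (exp ((c - a - \<mu> - 1) * (of_real P - of_real Q)) *
        exp ((a + b - c) * (- of_real Q)) * (exp (- a * (of_real P - of_real Q)) * H) *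
        (X * (E * exp ((\<mu> - 1) * (- of_real Q)))))"
      by (simp only: exp_add mult_ac)
    finally show "of_real x powr (\<mu> - 1) * (of_real s powr (\<delta> - 1) * of_real (1 - s) powr (\<gamma> - 1)
            * hyp2F1 a (c - b) \<gamma> (of_real (1 - s)) * (1 - of_real \<eta> * of_real s) powr (- (1 - \<mu>))) =
        (1 / (1 - s)\<^sup>2) *\<^sub>R (of_real (- (- s / (1 - s))) powr (c - a - \<mu> - 1) *
          of_real (1 - - s / (1 - s)) powr (a + b - c) *
          w\<^sub>3 (- s / (1 - s)) a b c * of_real (x - - s / (1 - s)) powr (\<mu> - 1))"
      unfolding w\<^sub>3_def scaleR_conv_of_real F k jac p4 my(1,2,3) p1 p2 p3 H_def[symmetric] X_def[symmetric] E_def[symmetric] .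
  next
    \<comment> \<open>Pfaff at 1 - x fits because (1 - x) / ((1 - x) - 1) = 1 - 1/x =
      \<eta>.\<close>
    have "hyp2F1 (c - (a + \<mu>)) (c - b) C (of_real (1 - x)) =
        (1 - of_real (1 - x)) powr (- (c - (a + \<mu>))) *
          hyp2F1 (c - (a + \<mu>)) (C - (c - b)) C (of_real (1 - x) / (of_real (1 - x) - 1))"
      using x0 by (intro hyp2F1_Pfaff C' of_real_in_slit_plane) auto
    also have "of_real (1 - x) / (of_real (1 - x) - 1) = complex_of_real \<eta>"
      using x0 by (simp add: \<eta>_def field_simps)
    also have "hyp2F1 (c - (a + \<mu>)) (C - (c - b)) C (of_real \<eta>) = hyp2F1 (1 - a - \<mu>) \<delta> C (of_real \<eta>)"
      by (subst hyp2F1_commute) (simp add: C_def \<delta>_def algebra_simps)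
    finally have F: "hyp2F1 (c - (a + \<mu>)) (c - b) C (of_real (1 - x)) =
        of_real x powr (- \<delta>) * hyp2F1 (1 - a - \<mu>) \<delta> C (of_real \<eta>)"
      by (simp add: \<delta>_def algebra_simps)
    have "of_real x powr (c - a - 1) * of_real \<bar>1 - x\<bar> powr (a + b - c + \<mu>) * w\<^sub>6 x (a + \<mu>) b c =
        (of_real x powr (c - a - 1) * of_real x powr (- \<delta>)) *
        (of_real \<bar>1 - x\<bar> powr (a + b - c + \<mu>) * of_real \<bar>1 - x\<bar> powr (c - (a + \<mu>) - b)) *
        hyp2F1 (1 - a - \<mu>) \<delta> C (of_real \<eta>)"
      unfolding w\<^sub>6_def C_def[symmetric] F by (simp only: mult_ac)
    also have "of_real x powr (c - a - 1) * of_real x powr (- \<delta>) = of_real x powr (\<mu> - 1)"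
      by (simp add: \<delta>_def algebra_simps flip: powr_add)
    \<comment> \<open>\<open>w\<^sub>6\<close> carries the opposite power of |1 - x|, so the
      prefactor in the claim only compensates it.\<close>
    also have "of_real \<bar>1 - x\<bar> powr (a + b - c + \<mu>) * of_real \<bar>1 - x\<bar> powr (c - (a + \<mu>) - b) = (1 :: complex)"
      unfolding of_real_powr_eq_exp[OF x0(2)] by (simp add: algebra_simps flip: exp_add)
    finally show "of_real x powr (\<mu> - 1) * (K * hyp2F1 (1 - a - \<mu>) \<delta> C (of_real \<eta>)) =
        Gamma (- a - \<mu> + 1) * Gamma (c - a - \<mu>) * Gamma (a - b + 1)
            * rGamma (c - a - b - \<mu> + 1) * rGamma (1 - \<mu>)
            * of_real x powr (c - a - 1) * of_real \<bar>1 - x\<bar> powr (a + b - c + \<mu>)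
            * w\<^sub>6 x (a + \<mu>) b c"
      by (simp add: K_def \<gamma>_def \<delta>_def C_def algebra_simps)
  qed
  finally show ?thesis .
qed

lemma w\<^sub>4_eq_w\<^sub>3: "w\<^sub>4 x a b c = w\<^sub>3 x b a c"
  by (simp add: w\<^sub>3_def w\<^sub>4_def)

lemma w\<^sub>5_commute: "w\<^sub>5 x a b c = w\<^sub>5 x b a c"
  by (simp add: w\<^sub>5_def add.commute[of a] hyp2F1_commute[of a])

lemma w\<^sub>6_commute: "w\<^sub>6 x a b c = w\<^sub>6 x b a c"
proof -
  have "c - a - b = c - b - a" by simp
  then show ?thesis by (simp only: w\<^sub>6_def hyp2F1_commute[of "c - a"])
qed

theorem mainTheorem13:
  fixes a b c \<mu> :: complex
  shows
    "(Re (- a - \<mu> + 1) > 0 \<and> Re (c - a - \<mu>) > 0 \<and> Re (a - b + 1) > 0 \<and>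
     a - b + 1 \<notin> \<int>\<^sub>\<le>\<^sub>0 \<and> c - (a + \<mu>) - b + 1 \<notin> \<int>\<^sub>\<le>\<^sub>0
      \<longrightarrow> (\<forall>x::real. x \<in> {0<..<1} \<union> {1<..} \<longrightarrow>
       has_bochner_integral (lebesgue_on {..<0})
         (\<lambda>y. of_real (- y) powr (c - a - \<mu> - 1) * of_real (1 - y) powr (a + b - c)
              * w\<^sub>3 y a b c * of_real (x - y) powr (\<mu> - 1))
         (Gamma (- a - \<mu> + 1) * Gamma (c - a - \<mu>) * Gamma (a - b + 1)
            * rGamma (c - a - b - \<mu> + 1) * rGamma (1 - \<mu>)
            * of_real x powr (c - a - 1) * of_real \<bar>1 - x\<bar> powr (a + b - c + \<mu>)
            * w\<^sub>6 x (a + \<mu>) b c)))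
     \<and>
     (Re (- a - \<mu> + 1) > 0 \<and> Re (c - a - \<mu>) > 0 \<and> Re (a + b - c + 1) > 0 \<and>
     a + b - c + 1 \<notin> \<int>\<^sub>\<le>\<^sub>0 \<and> b - (a + \<mu>) + 1 \<notin> \<int>\<^sub>\<le>\<^sub>0
      \<longrightarrow> (\<forall>x::real. x \<in> {..<0} \<union> {1<..} \<longrightarrow>
       has_bochner_integral (lebesgue_on {0<..<1})
         (\<lambda>y. of_real y powr (c - a - \<mu> - 1) * of_real (1 - y) powr (a + b - c)
              * w\<^sub>5 y a b c * of_real \<bar>x - y\<bar> powr (\<mu> - 1))
         (Gamma (- a - \<mu> + 1) * Gamma (c - a - \<mu>) * Gamma (a + b - c + 1)
            * rGamma (b - a - \<mu> + 1) * rGamma (1 - \<mu>)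
            * of_real \<bar>x\<bar> powr (c - a - 1) * of_real \<bar>1 - x\<bar> powr (a + b - c + \<mu>)
            * w\<^sub>4 x (a + \<mu>) b c)))
     \<and>
     (Re (- b - \<mu> + 1) > 0 \<and> Re (c - b - \<mu>) > 0 \<and> Re (b - a + 1) > 0 \<and>
     b - a + 1 \<notin> \<int>\<^sub>\<le>\<^sub>0 \<and> c - a - (b + \<mu>) + 1 \<notin> \<int>\<^sub>\<le>\<^sub>0
      \<longrightarrow> (\<forall>x::real. x \<in> {0<..<1} \<union> {1<..} \<longrightarrow>
       has_bochner_integral (lebesgue_on {..<0})
         (\<lambda>y. of_real (- y) powr (c - b - \<mu> - 1) * of_real (1 - y) powr (a + b - c)
              * w\<^sub>4 y a b c * of_real (x - y) powr (\<mu> - 1))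
         (Gamma (- b - \<mu> + 1) * Gamma (c - b - \<mu>) * Gamma (b - a + 1)
            * rGamma (c - a - b - \<mu> + 1) * rGamma (1 - \<mu>)
            * of_real x powr (c - b - 1) * of_real \<bar>1 - x\<bar> powr (a + b - c + \<mu>)
            * w\<^sub>6 x a (b + \<mu>) c)))
     \<and>
     (Re (- b - \<mu> + 1) > 0 \<and> Re (c - b - \<mu>) > 0 \<and> Re (a + b - c + 1) > 0 \<and>
     a + b - c + 1 \<notin> \<int>\<^sub>\<le>\<^sub>0 \<and> a - (b + \<mu>) + 1 \<notin> \<int>\<^sub>\<le>\<^sub>0
      \<longrightarrow> (\<forall>x::real. x \<in> {..<0} \<union> {1<..} \<longrightarrow>
       has_bochner_integral (lebesgue_on {0<..<1})
         (\<lambda>y. of_real y powr (c - b - \<mu> - 1) * of_real (1 - y) powr (a + b - c)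
              * w\<^sub>5 y a b c * of_real \<bar>x - y\<bar> powr (\<mu> - 1))
         (Gamma (- b - \<mu> + 1) * Gamma (c - b - \<mu>) * Gamma (a + b - c + 1)
            * rGamma (a - b - \<mu> + 1) * rGamma (1 - \<mu>)
            * of_real \<bar>x\<bar> powr (c - b - 1) * of_real \<bar>1 - x\<bar> powr (a + b - c + \<mu>)
            * w\<^sub>3 x a (b + \<mu>) c)))"
proof -
  \<comment> \<open>Exchanging a and b swaps \<open>w\<^sub>3\<close> with \<open>w\<^sub>4\<close>
    and fixes \<open>w\<^sub>5\<close> and \<open>w\<^sub>6\<close>; these equations restore the
    order of parameters required in (3) and (4).\<close>
  have eqs: "b + a = a + b" "c - b - a = c - a - b" "c - (b + \<mu>) - a = c - a - (b + \<mu>)" by simp_all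
  note swap = eqs w\<^sub>4_eq_w\<^sub>3 w\<^sub>5_commute[of _ b a] w\<^sub>6_commute[of _ "b + \<mu>" a]
  show ?thesis
    using has_bochner_integral_w\<^sub>3[of a \<mu> c b] has_bochner_integral_w\<^sub>5[of a \<mu> c b]
      has_bochner_integral_w\<^sub>3[of b \<mu> c a, unfolded swap] has_bochner_integral_w\<^sub>5[of b \<mu> c a, unfolded swap]
    unfolding w\<^sub>4_eq_w\<^sub>3 by blast
qed

end
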